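(* Let $G$ be an infinite unbounded Abelian group, i.e. $\exp G=\infty$, and let $H$ be a countable (finite or infinite) torsion subgroup of $G$. Then there exists a complete Hausdorff group topology $\tau$ on $G$ such that $\mathbf{n}(G,\tau)=H$; that is, $H\in\mathcal{NRC}(G)$.
   Context: Groups are Abelian and written additively. $\exp G$ is the least common multiple of the orders of the elements of $G$; $G$ is unbounded if $\exp G=\infty$ (in particular if $G$ has an element of infinite order), and bounded otherwise. For a topological Abelian group $X$, $X^\wedge$ denotes the group of continuous characters (continuous homomorphisms to the circle group), and $\mathbf{n}(X)=\bigcap_{\chi\in X^\wedge}\ker\chi$ is the von Neumann radical of $X$. For an infinite Abelian group $G$, $\mathcal{NRC}(G)$ is the set of all subgroups $H$ of $G$ for which there exists a complete non-discrete Hausdorff group topology $\tau$ on $G$ with $\mathbf{n}(G,\tau)=H$. *)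

theory Defs
  imports
    "HOL-Analysis.Analysis"
    "HOL-Algebra.Multiplicative_Group"
    "HOL-Library.Extended_Nat"
begin

text \<open>Abelian groups are \<open>comm_group\<close>s of \<open>HOL-Algebra\<close>, hence written multiplicatively.\<close>

text \<open>In \<open>HOL-Algebra\<close> the order of an element is \<open>0\<close> if it generates an infinite cyclic
  group, and \<open>Lcm\<close> on \<^typ>\<open>nat\<close> is \<open>0\<close> exactly if the set contains \<open>0\<close> or is infinite, that is,
  if it has no positive common multiple.\<close>

definition group_exp :: "('a, 'b) monoid_scheme \<Rightarrow> enat" where
  "group_exp G =
    (let m = Lcm (group.ord G ` carrier G) in if m = 0 then \<infinity> else enat m)"

definition torsion_subgroup :: "'a set \<Rightarrow> ('a, 'b) monoid_scheme \<Rightarrow> bool" where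
  "torsion_subgroup H G \<longleftrightarrow>
    subgroup H G \<and> (\<forall>h\<in>H. \<exists>n::nat. n > 0 \<and> h [^]\<^bsub>G\<^esub> n = \<one>\<^bsub>G\<^esub>)"

definition group_topology :: "('a, 'b) monoid_scheme \<Rightarrow> 'a topology \<Rightarrow> bool" where
  "group_topology G \<tau> \<longleftrightarrow>
    topspace \<tau> = carrier G \<and>
    continuous_map (prod_topology \<tau> \<tau>) \<tau> (\<lambda>(x, y). x \<otimes>\<^bsub>G\<^esub> y) \<and>
    continuous_map \<tau> \<tau> (\<lambda>x. inv\<^bsub>G\<^esub> x)"

text \<open>Completeness is meant with respect to the group uniformity, whose entourages are generated
  by the sets of pairs \<open>(x, y)\<close> with \<open>x y\<^sup>-\<^sup>1 \<in> U\<close> for a neighbourhood \<open>U\<close> of the identity. For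
  Abelian groups the left and right uniformities coincide.\<close>

definition cauchy_filter_group ::
    "('a, 'b) monoid_scheme \<Rightarrow> 'a topology \<Rightarrow> 'a filter \<Rightarrow> bool" where
  "cauchy_filter_group G \<tau> F \<longleftrightarrow>
    F \<noteq> bot \<and> F \<le> principal (carrier G) \<and>
    (\<forall>U. openin \<tau> U \<and> \<one>\<^bsub>G\<^esub> \<in> U \<longrightarrow>
      (\<forall>\<^sub>F (x, y) in F \<times>\<^sub>F F. x \<otimes>\<^bsub>G\<^esub> inv\<^bsub>G\<^esub> y \<in> U))"

definition complete_group_topology :: "('a, 'b) monoid_scheme \<Rightarrow> 'a topology \<Rightarrow> bool" where
  "complete_group_topology G \<tau> \<longleftrightarrow>
    (\<forall>F. cauchy_filter_group G \<tau> F \<longrightarrow> (\<exists>l. limitin \<tau> (\<lambda>x. x) l F))"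

definition circle_group :: "complex monoid" where
  "circle_group = \<lparr>carrier = sphere 0 1, mult = (*), one = 1\<rparr>"

text \<open>Maps that agree on the carrier represent the same character; only their restrictions to the
  carrier enter the kernels below.\<close>

definition continuous_characters ::
    "('a, 'b) monoid_scheme \<Rightarrow> 'a topology \<Rightarrow> ('a \<Rightarrow> complex) set" where
  "continuous_characters G \<tau> =
    {f \<in> hom G circle_group. continuous_map \<tau> (top_of_set (sphere 0 1)) f}"

definition von_neumann_radical :: "('a, 'b) monoid_scheme \<Rightarrow> 'a topology \<Rightarrow> 'a set" where
  "von_neumann_radical G \<tau> = (\<Inter>f\<in>continuous_characters G \<tau>. kernel G circle_group f)"

definition NRC :: "('a, 'b) monoid_scheme \<Rightarrow> 'a set set" where
  "NRC G = {H. subgroup H G \<and>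
    (\<exists>\<tau>. group_topology G \<tau> \<and> complete_group_topology G \<tau> \<and> Hausdorff_space \<tau> \<and>
      \<tau> \<noteq> discrete_topology (carrier G) \<and> von_neumann_radical G \<tau> = H)}"

end

theory Submission
  imports Defs
begin

text \<open>Let \<open>w\<^sub>0, w\<^sub>1, \<dots>\<close> be finite symmetric subsets of \<open>G\<close> containing the identity, and let
  \<open>A\<^sub>n\<close> be the union of the \<open>w\<^sub>k\<close> with \<open>k \<ge> n\<close>. The sets
  \<open>\<Union>k. A\<^bsub>f 0\<^esub> A\<^bsub>f 1\<^esub> \<cdots> A\<^bsub>f (k - 1)\<^esub>\<close>, one for each \<open>f : \<nat> \<rightarrow> \<nat>\<close>, are the basic
  neighbourhoods of the identity for a group topology; this is the construction of Protasov and
  Zelenyuk for sequences, with finite sets in place of single elements. Two of its features are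
  general: the topology is complete (\<open>complete_nbhd_topology\<close>), and a character is continuous if
  and only if it tends to \<open>1\<close> along the \<open>A\<^sub>n\<close> (\<open>continuous_character_iff\<close>). So the theorem comes
  down to a choice of the \<open>w\<^sub>n\<close> that forces every character tending to \<open>1\<close> to be trivial on \<open>H\<close>,
  leaves enough such characters to detect all elements outside \<open>H\<close>, and is sparse enough for the
  topology to be Hausdorff.

  Let \<open>h\<^sub>0, h\<^sub>1, \<dots>\<close> list every element of \<open>H\<close> infinitely often. The set \<open>w\<^sub>n\<close> consists of the
  identity, of the powers \<open>e\<^sub>j\<^sup>m\<close> with \<open>\<bar>m\<bar> \<le> n + 1\<close> of elements \<open>e\<^sub>0, \<dots>, e\<^sub>n\<close>, and of
  \<open>h\<^sub>n e\<^sub>0 \<cdots> e\<^sub>n\<close> and its inverse.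

  \<^item> Forcing. If \<open>\<phi>\<close> is within \<open>\<epsilon> \<le> 1 / 2\<close> of \<open>1\<close> on all those powers of \<open>e\<^sub>j\<close>, then \<open>\<phi> e\<^sub>j\<close> is within
    \<open>2\<epsilon> / (n + 1)\<close> of \<open>1\<close>. Hence \<open>\<phi> (e\<^sub>0 \<cdots> e\<^sub>n)\<close> is within \<open>2\<epsilon>\<close> and \<open>\<phi> h\<^sub>n\<close> within \<open>3\<epsilon>\<close> of \<open>1\<close>
    (\<open>block_forces_small\<close>). Letting \<open>n\<close> run through the indices of a given element of \<open>H\<close> shows
    that a continuous character is trivial there.

  \<^item> Sparseness. For \<open>f j = j + l + 1\<close>, an element of the basic neighbourhood is a product with at
    most \<open>n\<close> factors from each \<open>w\<^sub>n\<close>. The \<open>e\<^sub>j\<close> are chosen so independent of everything chosen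
    before that a cancellation at stage \<open>n\<close> must cancel each of the \<open>n + 1\<close> elements \<open>e\<^sub>j\<close>
    separately, and \<open>n\<close> factors cannot do this (\<open>block_products_avoid\<close>). So \<open>h\<^sub>l\<close> is not in this
    neighbourhood, unless it is the identity (\<open>levels_avoid\<close>). Elements outside \<open>H\<close> are separated
    from the identity by continuous characters.

  \<^item> Existence of the \<open>e\<^sub>j\<close>. In an unbounded group there are elements all of whose first \<open>q\<close> powers
    avoid a given finite set: powers of an element of infinite order, or else elements of large
    finite order. They can be taken in one countable subgroup \<open>Y\<close> that contains \<open>H\<close>
    (\<open>countable_power_avoiding\<close>).

  \<^item> Enough characters. Characters of a subgroup extend to \<open>G\<close>, so countably many characters
    \<open>\<psi>\<^sub>0, \<psi>\<^sub>1, \<dots>\<close> that are trivial on \<open>H\<close> detect every element of \<open>Y - H\<close>. By the pigeonhole principle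
    each \<open>e\<^sub>j\<close> can be taken as a quotient of two elements that \<open>\<psi>\<^sub>0, \<dots>, \<psi>\<^sub>n\<close> hardly distinguish
    (\<open>power_avoiding_near_kernel\<close>), which makes every \<open>\<psi>\<^sub>i\<close> continuous. Elements outside \<open>Y\<close> are
    detected by characters that are trivial on \<open>Y\<close>.\<close>

section \<open>Products of sequences of sets\<close>

context comm_group
begin

primrec prefix_product :: "(nat \<Rightarrow> 'a set) \<Rightarrow> nat \<Rightarrow> 'a set" where
  "prefix_product B 0 = {\<one>}"
| "prefix_product B (Suc k) = prefix_product B k <#> B k"

lemma mem_set_mult: "x \<in> A <#> B \<longleftrightarrow> (\<exists>a\<in>A. \<exists>b\<in>B. x = a \<otimes> b)"
  by (auto simp: set_mult_def)

lemma prefix_product_closed: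
  "(\<And>k. k < n \<Longrightarrow> B k \<subseteq> carrier G) \<Longrightarrow> prefix_product B n \<subseteq> carrier G"
proof (induction n)
  case (Suc n)
  then show ?case using set_mult_closed[of "prefix_product B n" "B n"] by simp
qed simp

lemma prefix_product_finite:
  "(\<And>k. k < n \<Longrightarrow> finite (B k)) \<Longrightarrow> finite (prefix_product B n)"
  by (induction n) (auto simp: set_mult_def)

lemma one_in_prefix_product: "(\<And>k. k < n \<Longrightarrow> \<one> \<in> B k) \<Longrightarrow> \<one> \<in> prefix_product B n"
  by (induction n) (auto simp: mem_set_mult intro!: bexI[of _ \<one>])

lemma prefix_product_mono:
  "(\<And>k. k < n \<Longrightarrow> B k \<subseteq> C k) \<Longrightarrow> prefix_product B n \<subseteq> prefix_product C n"
proof (induction n)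
  case (Suc n)
  then show ?case by (simp add: mono_set_mult)
qed simp

lemma prefix_product_subset_later:
  assumes "\<And>k. B k \<subseteq> carrier G" "\<And>k. \<one> \<in> B k" "n \<le> m"
  shows "prefix_product B n \<subseteq> prefix_product B m"
  using \<open>n \<le> m\<close>
proof (induction m rule: dec_induct)
  case (step m)
  have "prefix_product B m \<subseteq> prefix_product B (Suc m)"
  proof
    fix x assume x: "x \<in> prefix_product B m"
    then have "x = x \<otimes> \<one>" using prefix_product_closed[of m B] assms(1) by auto
    then show "x \<in> prefix_product B (Suc m)"
      using x assms(2) by (auto simp: mem_set_mult)
  qed
  then show ?case using step by blast
qed simp

lemma prefix_product_append:
  assumes "\<And>k. B k \<subseteq> carrier G"
  shows "prefix_product B (n + m) = prefix_product B n <#> prefix_product (\<lambda>k. B (n + k)) m"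
proof (induction m)
  case 0
  have "prefix_product B n \<subseteq> carrier G" using prefix_product_closed assms by auto
  then show ?case by (force simp: set_mult_def)
next
  case (Suc m)
  have "prefix_product B n \<subseteq> carrier G" "prefix_product (\<lambda>k. B (n + k)) m \<subseteq> carrier G"
    using prefix_product_closed assms by auto
  then show ?case using Suc set_mult_assoc assms by simp
qed

lemma prefix_product_inv:
  assumes "\<And>k. B k \<subseteq> carrier G" "\<And>k x. x \<in> B k \<Longrightarrow> inv x \<in> B k" "x \<in> prefix_product B n"
  shows "inv x \<in> prefix_product B n"
  using assms(3)
proof (induction n arbitrary: x)
  case (Suc n)
  then obtain a b where ab: "a \<in> prefix_product B n" "b \<in> B n" "x = a \<otimes> b"
    by (auto simp: mem_set_mult)
  then have "a \<in> carrier G" "b \<in> carrier G" using prefix_product_closed[of n B] assms(1) by auto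
  then have "inv x = inv a \<otimes> inv b" using ab by (simp add: inv_mult)
  then show ?case using Suc.IH[OF ab(1)] assms(2)[OF ab(2)] by (auto simp: mem_set_mult)
qed simp

text \<open>In an abelian group the factors of two products can be merged alternately. This yields,
  for each basic neighbourhood below, another one whose square it contains.\<close>

lemma prefix_product_interleave:
  assumes "\<And>k. B k \<subseteq> carrier G"
  shows "prefix_product B n <#> prefix_product B n \<subseteq> prefix_product (\<lambda>k. B (k div 2)) (2 * n)"
proof (induction n)
  case (Suc n)
  let ?C = "\<lambda>k. B (k div 2)"
  have cl: "prefix_product B n \<subseteq> carrier G" using prefix_product_closed assms by auto
  show ?case
  proof
    fix z assume "z \<in> prefix_product B (Suc n) <#> prefix_product B (Suc n)"
    then obtain a b c d where *: "a \<in> prefix_product B n" "b \<in> B n" "c \<in> prefix_product B n"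
        "d \<in> B n" "z = (a \<otimes> b) \<otimes> (c \<otimes> d)"
      by (auto simp: mem_set_mult)
    then have "a \<in> carrier G" "b \<in> carrier G" "c \<in> carrier G" "d \<in> carrier G"
      using cl assms by auto
    then have "z = ((a \<otimes> c) \<otimes> b) \<otimes> d" using *(5) by (simp add: m_ac)
    moreover have "a \<otimes> c \<in> prefix_product ?C (2 * n)"
      using Suc *(1,3) by (blast intro: mem_set_mult[THEN iffD2])
    ultimately show "z \<in> prefix_product ?C (2 * Suc n)"
      using *(2,4) by (auto intro!: mem_set_mult[THEN iffD2] bexI)
  qed
qed (auto simp: mem_set_mult)

end

section \<open>The group topology of a shrinking sequence of sets\<close>

locale shrinking_sets = comm_group G for G (structure) +
  fixes A :: "nat \<Rightarrow> 'a set"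
  assumes A_closed: "A n \<subseteq> carrier G"
    and A_one: "\<one> \<in> A n"
    and A_inv: "x \<in> A n \<Longrightarrow> inv x \<in> A n"
    and A_anti: "n \<le> m \<Longrightarrow> A m \<subseteq> A n"
begin

lemma A_carrier [simp]: "x \<in> A n \<Longrightarrow> x \<in> carrier G"
  using A_closed by blast

text \<open>The indices \<open>f j\<close> control how often small indices may occur: the \<open>j\<close>-th factor has to come from
  the tail \<open>A (f j)\<close>, but the number of factors is not bounded.\<close>

definition nbhd :: "(nat \<Rightarrow> nat) \<Rightarrow> 'a set" where
  "nbhd f = (\<Union>k. prefix_product (\<lambda>j. A (f j)) k)"

definition nbhd_topology :: "'a topology" where
  "nbhd_topology =
    topology (\<lambda>U. U \<subseteq> carrier G \<and> (\<forall>x\<in>U. \<exists>f. \<forall>u\<in>nbhd f. x \<otimes> u \<in> U))"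

lemma nbhd_closed: "nbhd f \<subseteq> carrier G"
  unfolding nbhd_def by (intro UN_least prefix_product_closed A_closed)

lemma nbhd_carrier [simp]: "u \<in> nbhd f \<Longrightarrow> u \<in> carrier G"
  using nbhd_closed by blast

lemma one_in_nbhd [simp]: "\<one> \<in> nbhd f"
  unfolding nbhd_def using prefix_product.simps(1)[of "\<lambda>j. A (f j)"] by blast

lemma nbhd_inv:
  assumes "x \<in> nbhd f"
  shows "inv x \<in> nbhd f"
proof -
  obtain k where "x \<in> prefix_product (\<lambda>j. A (f j)) k" using assms unfolding nbhd_def by blast
  then have "inv x \<in> prefix_product (\<lambda>j. A (f j)) k"
    by (rule prefix_product_inv[rotated -1]) (use A_closed A_inv in auto)
  then show ?thesis unfolding nbhd_def by blast
qed

lemma nbhd_anti: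
  assumes "\<And>j. f j \<le> g j"
  shows "nbhd g \<subseteq> nbhd f"
proof -
  have "prefix_product (\<lambda>j. A (g j)) k \<subseteq> prefix_product (\<lambda>j. A (f j)) k" for k
    by (rule prefix_product_mono) (simp add: A_anti assms)
  then show ?thesis unfolding nbhd_def by blast
qed

lemma A_subset_nbhd: "A (f 0) \<subseteq> nbhd f"
proof
  fix x assume x: "x \<in> A (f 0)"
  then have "x = \<one> \<otimes> x" by simp
  then have "x \<in> prefix_product (\<lambda>j. A (f j)) (Suc 0)"
    using x by (auto simp: mem_set_mult)
  then show "x \<in> nbhd f" unfolding nbhd_def by blast
qed

text \<open>Merging two products with factors in \<open>A (g 0), A (g 1), \<dots>\<close> puts the \<open>i\<close>-th factors in the
  positions \<open>2 * i\<close> and \<open>2 * i + 1\<close>, so \<open>g i\<close> has to dominate both \<open>f (2 * i)\<close> and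
  \<open>f (2 * i + 1)\<close>.\<close>

lemma nbhd_square: "\<exists>g. nbhd g <#> nbhd g \<subseteq> nbhd f"
proof -
  define g where "g = (\<lambda>i. max (f (2 * i)) (f (2 * i + 1)))"
  let ?P = "prefix_product (\<lambda>j. A (g j))"
  have "x \<otimes> y \<in> nbhd f" if "x \<in> ?P n" "y \<in> ?P m" for x y n m
  proof -
    have "?P n \<subseteq> ?P (max n m)" "?P m \<subseteq> ?P (max n m)"
      by (rule prefix_product_subset_later; simp add: A_closed A_one)+
    then have "x \<in> ?P (max n m)" "y \<in> ?P (max n m)"
      using that by blast+
    then have "x \<otimes> y \<in> prefix_product (\<lambda>k. A (g (k div 2))) (2 * max n m)"
      using prefix_product_interleave[of "\<lambda>j. A (g j)" "max n m", OF A_closed]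
      by (blast intro: mem_set_mult[THEN iffD2])
    moreover have "f k \<le> g (k div 2)" for k
      by (cases "even k") (auto simp: g_def elim!: evenE oddE)
    then have "prefix_product (\<lambda>k. A (g (k div 2))) (2 * max n m)
        \<subseteq> prefix_product (\<lambda>k. A (f k)) (2 * max n m)"
      by (intro prefix_product_mono A_anti)
    ultimately show ?thesis unfolding nbhd_def by blast
  qed
  then have "nbhd g <#> nbhd g \<subseteq> nbhd f"
    by (auto simp: mem_set_mult nbhd_def[of g])
  then show ?thesis by blast
qed

lemma nbhd_squareE:
  obtains g where "\<And>x y. x \<in> nbhd g \<Longrightarrow> y \<in> nbhd g \<Longrightarrow> x \<otimes> y \<in> nbhd f"
  using nbhd_square[of f] by (auto simp: mem_set_mult subset_iff)

lemma istopology_nbhd: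
  "istopology (\<lambda>U. U \<subseteq> carrier G \<and> (\<forall>x\<in>U. \<exists>f. \<forall>u\<in>nbhd f. x \<otimes> u \<in> U))"
  unfolding istopology_def
proof (intro conjI allI impI)
  fix S T
  assume S: "S \<subseteq> carrier G \<and> (\<forall>x\<in>S. \<exists>f. \<forall>u\<in>nbhd f. x \<otimes> u \<in> S)"
    and T: "T \<subseteq> carrier G \<and> (\<forall>x\<in>T. \<exists>f. \<forall>u\<in>nbhd f. x \<otimes> u \<in> T)"
  show "S \<inter> T \<subseteq> carrier G" using S by blast
  show "\<forall>x\<in>S \<inter> T. \<exists>f. \<forall>u\<in>nbhd f. x \<otimes> u \<in> S \<inter> T"
  proof
    fix x assume "x \<in> S \<inter> T"
    then obtain f g where fg: "\<forall>u\<in>nbhd f. x \<otimes> u \<in> S" "\<forall>u\<in>nbhd g. x \<otimes> u \<in> T"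
      using S T by blast
    have "nbhd (\<lambda>j. max (f j) (g j)) \<subseteq> nbhd f" "nbhd (\<lambda>j. max (f j) (g j)) \<subseteq> nbhd g"
      by (auto intro!: nbhd_anti)
    then show "\<exists>f. \<forall>u\<in>nbhd f. x \<otimes> u \<in> S \<inter> T" using fg by blast
  qed
next
  fix K assume "\<forall>S\<in>K. S \<subseteq> carrier G \<and> (\<forall>x\<in>S. \<exists>f. \<forall>u\<in>nbhd f. x \<otimes> u \<in> S)"
  then show "\<Union>K \<subseteq> carrier G" "\<forall>x\<in>\<Union>K. \<exists>f. \<forall>u\<in>nbhd f. x \<otimes> u \<in> \<Union>K"
    by (blast, meson UnionE UnionI)
qed

lemma openin_nbhd_topology:
  "openin nbhd_topology U \<longleftrightarrow>
    U \<subseteq> carrier G \<and> (\<forall>x\<in>U. \<exists>f. \<forall>u\<in>nbhd f. x \<otimes> u \<in> U)"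
  unfolding nbhd_topology_def using topology_inverse'[OF istopology_nbhd] by simp

lemma topspace_nbhd_topology [simp]: "topspace nbhd_topology = carrier G"
proof -
  have "openin nbhd_topology (carrier G)"
    unfolding openin_nbhd_topology by simp
  moreover have "topspace nbhd_topology \<subseteq> carrier G"
    using openin_topspace[of nbhd_topology] unfolding openin_nbhd_topology by simp
  ultimately show ?thesis using openin_subset by blast
qed

text \<open>A product of length \<open>k\<close> leaves room for any product whose \<open>j\<close>-th factor satisfies the condition for
  position \<open>k + j\<close>. Hence the basic neighbourhoods are themselves open.\<close>

lemma nbhd_shift:
  assumes "x \<in> nbhd f"
  shows "\<exists>g. \<forall>u\<in>nbhd g. x \<otimes> u \<in> nbhd f"
proof -
  let ?P = "prefix_product (\<lambda>j. A (f j))"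
  obtain k where k: "x \<in> ?P k" using assms unfolding nbhd_def by blast
  have "x \<otimes> u \<in> nbhd f" if "u \<in> nbhd (\<lambda>j. f (k + j))" for u
  proof -
    obtain m where "u \<in> prefix_product (\<lambda>j. A (f (k + j))) m"
      using \<open>u \<in> nbhd (\<lambda>j. f (k + j))\<close> unfolding nbhd_def by blast
    then have "x \<otimes> u \<in> ?P (k + m)"
      using k prefix_product_append[of "\<lambda>j. A (f j)" k m] A_closed by (auto simp: mem_set_mult)
    then show ?thesis unfolding nbhd_def by blast
  qed
  then show ?thesis by blast
qed

lemma openin_translate_nbhd:
  assumes "x \<in> carrier G"
  shows "openin nbhd_topology ((\<lambda>u. x \<otimes> u) ` nbhd f)"
  unfolding openin_nbhd_topology
proof (intro conjI ballI)
  show "(\<lambda>u. x \<otimes> u) ` nbhd f \<subseteq> carrier G" using assms by auto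
  fix y assume "y \<in> (\<lambda>u. x \<otimes> u) ` nbhd f"
  then obtain v where v: "v \<in> nbhd f" "y = x \<otimes> v" by blast
  obtain g where "\<forall>u\<in>nbhd g. v \<otimes> u \<in> nbhd f" using nbhd_shift v by blast
  then have "\<forall>u\<in>nbhd g. y \<otimes> u \<in> (\<lambda>u. x \<otimes> u) ` nbhd f"
    using v assms by (auto simp: m_assoc)
  then show "\<exists>f'. \<forall>u\<in>nbhd f'. y \<otimes> u \<in> (\<lambda>u. x \<otimes> u) ` nbhd f" by blast
qed

lemma group_topology_nbhd: "group_topology G nbhd_topology"
  unfolding group_topology_def
proof (intro conjI)
  show "continuous_map (prod_topology nbhd_topology nbhd_topology) nbhd_topology
      (\<lambda>(x, y). x \<otimes> y)"
    unfolding continuous_map_def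
  proof (intro conjI allI impI)
    fix U assume U: "openin nbhd_topology U"
    let ?W = "{p \<in> topspace (prod_topology nbhd_topology nbhd_topology).
      (case p of (x, y) \<Rightarrow> x \<otimes> y) \<in> U}"
    have "\<exists>V V'. openin nbhd_topology V \<and> openin nbhd_topology V' \<and> x \<in> V \<and> y \<in> V' \<and> V \<times> V' \<subseteq> ?W"
      if xy: "(x, y) \<in> ?W" for x y
    proof -
      have x: "x \<in> carrier G" and y: "y \<in> carrier G" and "x \<otimes> y \<in> U"
        using xy by auto
      then obtain f where f: "\<forall>u\<in>nbhd f. x \<otimes> y \<otimes> u \<in> U"
        using U unfolding openin_nbhd_topology by blast
      obtain g where g: "\<And>u v. u \<in> nbhd g \<Longrightarrow> v \<in> nbhd g \<Longrightarrow> u \<otimes> v \<in> nbhd f"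
        using nbhd_squareE by blast
      have "(x \<otimes> u) \<otimes> (y \<otimes> v) \<in> U" if "u \<in> nbhd g" "v \<in> nbhd g" for u v
      proof -
        have "(x \<otimes> u) \<otimes> (y \<otimes> v) = x \<otimes> y \<otimes> (u \<otimes> v)"
          using that x y by (simp add: m_ac)
        then show ?thesis using f g that by simp
      qed
      then have "(\<lambda>u. x \<otimes> u) ` nbhd g \<times> (\<lambda>u. y \<otimes> u) ` nbhd g \<subseteq> ?W"
        using x y by auto
      moreover have "x \<in> (\<lambda>u. x \<otimes> u) ` nbhd g" "y \<in> (\<lambda>u. y \<otimes> u) ` nbhd g"
        using x y by (auto intro!: image_eqI[of _ _ \<one>])
      ultimately show ?thesis using openin_translate_nbhd x y by blast
    qed
    then show "openin (prod_topology nbhd_topology nbhd_topology) ?W"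
      unfolding openin_prod_topology_alt by blast
  qed auto
  show "continuous_map nbhd_topology nbhd_topology (\<lambda>x. inv x)"
    unfolding continuous_map_def
  proof (intro conjI allI impI)
    fix U assume U: "openin nbhd_topology U"
    have "\<exists>f. \<forall>u\<in>nbhd f. x \<otimes> u \<in> {x \<in> carrier G. inv x \<in> U}"
      if x: "x \<in> carrier G" "inv x \<in> U" for x
    proof -
      obtain f where f: "\<forall>u\<in>nbhd f. inv x \<otimes> u \<in> U"
        using U x unfolding openin_nbhd_topology by blast
      have "\<forall>u\<in>nbhd f. x \<otimes> u \<in> {x \<in> carrier G. inv x \<in> U}"
        using f x nbhd_inv by (simp add: inv_mult)
      then show ?thesis by blast
    qed
    then show "openin nbhd_topology {x \<in> topspace nbhd_topology. inv x \<in> U}"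
      unfolding openin_nbhd_topology topspace_nbhd_topology by blast
  qed auto
qed simp

lemma Hausdorff_nbhd_topology:
  assumes "\<And>x. x \<in> carrier G \<Longrightarrow> x \<noteq> \<one> \<Longrightarrow> \<exists>f. x \<notin> nbhd f"
  shows "Hausdorff_space nbhd_topology"
  unfolding Hausdorff_space_def topspace_nbhd_topology
proof (intro allI impI, elim conjE)
  fix x y assume x: "x \<in> carrier G" and y: "y \<in> carrier G" and "x \<noteq> y"
  then have "x \<otimes> inv y \<noteq> \<one>" by (metis inv_equality inv_inv inv_closed)
  then obtain f where f: "x \<otimes> inv y \<notin> nbhd f" using assms x y by blast
  obtain g where g: "\<And>u v. u \<in> nbhd g \<Longrightarrow> v \<in> nbhd g \<Longrightarrow> u \<otimes> v \<in> nbhd f"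
    using nbhd_squareE by blast
  have "disjnt ((\<lambda>u. x \<otimes> u) ` nbhd g) ((\<lambda>u. y \<otimes> u) ` nbhd g)"
  proof -
    have False if "u \<in> nbhd g" "v \<in> nbhd g" "x \<otimes> u = y \<otimes> v" for u v
    proof -
      have uv: "u \<in> carrier G" "v \<in> carrier G" using that by auto
      have "x = y \<otimes> v \<otimes> inv u" using inv_solve_right[of x "y \<otimes> v" u] that uv x y by simp
      also have "\<dots> = (v \<otimes> inv u) \<otimes> y" using uv y by (simp add: m_ac)
      finally have "x \<otimes> inv y = v \<otimes> inv u"
        using inv_solve_right[of "v \<otimes> inv u" x y] uv x y by (metis inv_closed inv_solve_right' m_closed)
      then show False using g[OF that(2) nbhd_inv[OF that(1)]] f by simp
    qed
    then show ?thesis by (auto simp: disjnt_def)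
  qed
  moreover have "x \<in> (\<lambda>u. x \<otimes> u) ` nbhd g" "y \<in> (\<lambda>u. y \<otimes> u) ` nbhd g"
    using x y by (auto intro!: image_eqI[of _ _ \<one>])
  ultimately show "\<exists>U V. openin nbhd_topology U \<and> openin nbhd_topology V \<and> x \<in> U \<and> y \<in> V \<and> disjnt U V"
    using openin_translate_nbhd x y by blast
qed

lemma nbhd_topology_not_discrete:
  assumes "\<And>n. A n \<noteq> {\<one>}"
  shows "nbhd_topology \<noteq> discrete_topology (carrier G)"
proof
  assume "nbhd_topology = discrete_topology (carrier G)"
  then have "openin nbhd_topology {\<one>}" by simp
  then obtain f where "\<forall>u\<in>nbhd f. \<one> \<otimes> u \<in> {\<one>}"
    unfolding openin_nbhd_topology by blast
  then have "nbhd f \<subseteq> {\<one>}" by auto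
  then show False using A_subset_nbhd[of f] A_one assms by blast
qed

end

section \<open>Completeness\<close>

context shrinking_sets
begin

text \<open>\<open>F\<close> cannot be kept away from \<open>X\<close>: every set of the filter meets every uniform neighbourhood of \<open>X\<close>.\<close>

definition adheres :: "'a filter \<Rightarrow> 'a set \<Rightarrow> bool" where
  "adheres F X \<longleftrightarrow>
    (\<forall>P f. eventually P F \<longrightarrow> (\<exists>a\<in>X. \<exists>u\<in>nbhd f. P (a \<otimes> u)))"

lemma not_adheresE:
  assumes "\<not> adheres F X"
  obtains P f where "eventually P F" "\<And>a u. a \<in> X \<Longrightarrow> u \<in> nbhd f \<Longrightarrow> \<not> P (a \<otimes> u)"
  using assms unfolding adheres_def by blast

lemma cauchy_nbhdE:
  assumes "cauchy_filter_group G nbhd_topology F"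
  obtains P Q where "eventually P F" "eventually Q F"
    "\<And>x y. P x \<Longrightarrow> Q y \<Longrightarrow> x \<otimes> inv y \<in> nbhd f"
proof -
  have "openin nbhd_topology ((\<lambda>u. \<one> \<otimes> u) ` nbhd f)"
    by (rule openin_translate_nbhd[OF one_closed])
  moreover have "(\<lambda>u. \<one> \<otimes> u) ` nbhd f = nbhd f"
    by (auto simp: image_iff)
  ultimately have "\<forall>\<^sub>F (x, y) in F \<times>\<^sub>F F. x \<otimes> inv y \<in> nbhd f"
    using assms unfolding cauchy_filter_group_def by simp
  then show ?thesis using that unfolding eventually_prod_filter by auto
qed

lemma cauchy_carrier:
  assumes "cauchy_filter_group G nbhd_topology F"
  shows "eventually (\<lambda>x. x \<in> carrier G) F" "F \<noteq> bot"
  using assms unfolding cauchy_filter_group_def le_principal by auto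

text \<open>The points of a small set of the filter differ little from each other, and one of them is near \<open>a\<close>.\<close>

lemma cauchy_adheres_limit:
  assumes F: "cauchy_filter_group G nbhd_topology F"
    and a: "a \<in> carrier G" and ad: "adheres F {a}"
  shows "limitin nbhd_topology (\<lambda>x. x) a F"
  unfolding limitin_def topspace_nbhd_topology
proof (intro conjI allI impI a, elim conjE)
  fix U assume "openin nbhd_topology U" "a \<in> U"
  then obtain f where f: "\<forall>u\<in>nbhd f. a \<otimes> u \<in> U"
    unfolding openin_nbhd_topology by blast
  obtain g where g: "\<And>u v. u \<in> nbhd g \<Longrightarrow> v \<in> nbhd g \<Longrightarrow> u \<otimes> v \<in> nbhd f"
    using nbhd_squareE by blast
  obtain P Q where PQ: "eventually P F" "eventually Q F"
    "\<And>x y. P x \<Longrightarrow> Q y \<Longrightarrow> x \<otimes> inv y \<in> nbhd g"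
    using cauchy_nbhdE[OF F] by blast
  obtain u where u: "u \<in> nbhd g" "Q (a \<otimes> u)"
    using ad PQ(2) unfolding adheres_def by blast
  show "eventually (\<lambda>x. x \<in> U) F"
    using eventually_conj[OF PQ(1) cauchy_carrier(1)[OF F]]
  proof (rule eventually_mono, elim conjE)
    fix x assume x: "P x" "x \<in> carrier G"
    have uc: "u \<in> carrier G" using u by simp
    define d where "d = x \<otimes> inv (a \<otimes> u)"
    have d: "d \<in> nbhd g" using PQ(3) x u unfolding d_def by blast
    have "a \<otimes> (u \<otimes> d) = d \<otimes> (a \<otimes> u)"
      using a uc d by (simp add: m_ac)
    also have "\<dots> = x" unfolding d_def using a uc x by (simp add: m_assoc)
    finally have "a \<otimes> (u \<otimes> d) = x" .
    then show "x \<in> U" using f g[OF u(1) d] by metis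
  qed
qed

end

text \<open>Only finitely many points of \<open>A 0\<close> lie outside a given \<open>A n\<close>, so \<open>A 0\<close> is a null sequence together
  with its limit, the identity; it plays the part of a compact set.\<close>

locale null_sets = shrinking_sets +
  assumes A_cofinite: "finite (A 0 - A n)"
begin

abbreviation words :: "nat \<Rightarrow> 'a set" where
  "words n \<equiv> prefix_product (\<lambda>_. A 0) n"

lemma words_closed: "words n \<subseteq> carrier G"
  by (intro prefix_product_closed A_closed)

lemma words_carrier [simp]: "x \<in> words n \<Longrightarrow> x \<in> carrier G"
  using words_closed by blast

text \<open>This is compactness of the set of words of length \<open>n\<close>, proved one letter at a time. If the filter
  avoids a neighbourhood of \<open>a \<otimes> c \<otimes> words n\<close> for each letter \<open>c\<close>, then the neighbourhood for
  \<open>c = \<one>\<close> takes care of all letters close to the identity, and the finitely many other letters allow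
  a common neighbourhood. So the filter would avoid the words of length \<open>n + 1\<close>.\<close>

lemma adheres_words_point:
  assumes "a \<in> carrier G" and "adheres F ((\<lambda>k. a \<otimes> k) ` words n)"
  shows "\<exists>b\<in>carrier G. adheres F {b}"
  using assms
proof (induction n arbitrary: a)
  case 0
  then show ?case by auto
next
  case (Suc n)
  show ?case
  proof (rule ccontr)
    assume no: "\<not> ?case"
    have "\<exists>P f. eventually P F \<and> (\<forall>k\<in>words n. \<forall>u\<in>nbhd f. \<not> P (a \<otimes> c \<otimes> k \<otimes> u))"
      if "c \<in> A 0" for c
    proof -
      have "\<not> adheres F ((\<lambda>k. (a \<otimes> c) \<otimes> k) ` words n)"
        using Suc.IH[of "a \<otimes> c"] Suc.prems(1) no that by auto
      then show ?thesis by (elim not_adheresE) blast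
    qed
    then obtain P f where ev: "\<And>c. c \<in> A 0 \<Longrightarrow> eventually (P c) F"
      and Pf: "\<And>c k u. c \<in> A 0 \<Longrightarrow> k \<in> words n \<Longrightarrow> u \<in> nbhd (f c) \<Longrightarrow> \<not> P c (a \<otimes> c \<otimes> k \<otimes> u)"
      by metis
    obtain g where g: "\<And>u v. u \<in> nbhd g \<Longrightarrow> v \<in> nbhd g \<Longrightarrow> u \<otimes> v \<in> nbhd (f \<one>)"
      using nbhd_squareE by blast
    define D where "D = A 0 - A (g 0)"
    have D: "finite D" "D \<subseteq> A 0" using A_cofinite by (auto simp: D_def)
    define h where "h = (\<lambda>j. Max (insert (g j) ((\<lambda>c. f c j) ` D)))"
    have hg: "nbhd h \<subseteq> nbhd g"
      by (rule nbhd_anti) (simp add: h_def D)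
    have hf: "nbhd h \<subseteq> nbhd (f c)" if "c \<in> D" for c
      by (rule nbhd_anti) (use that D in \<open>auto simp: h_def intro!: Max_ge\<close>)
    have "eventually (\<lambda>x. P \<one> x \<and> (\<forall>c\<in>D. P c x)) F"
      using ev D A_one by (auto intro!: eventually_conj eventually_ball_finite)
    then obtain k u where k: "k \<in> words (Suc n)" and u: "u \<in> nbhd h"
      and P: "P \<one> (a \<otimes> k \<otimes> u)" "\<And>c. c \<in> D \<Longrightarrow> P c (a \<otimes> k \<otimes> u)"
      using Suc.prems(2) unfolding adheres_def by fast
    obtain k' c where k': "k' \<in> words n" and c: "c \<in> A 0" and kc: "k = k' \<otimes> c"
      using k by (auto simp: mem_set_mult)
    have car: "k' \<in> carrier G" "c \<in> carrier G" "u \<in> carrier G" "a \<in> carrier G"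
      using k' c u Suc.prems by auto
    show False
    proof (cases "c \<in> D")
      case True
      have "a \<otimes> k \<otimes> u = a \<otimes> c \<otimes> k' \<otimes> u" using car by (simp add: kc m_ac)
      then show False using Pf[OF c k', of u] P(2)[OF True] hf[OF True] u by auto
    next
      case False
      then have "c \<in> nbhd g" using c A_subset_nbhd[of g] by (auto simp: D_def)
      then have "c \<otimes> u \<in> nbhd (f \<one>)" using g u hg by blast
      then have "\<not> P \<one> (a \<otimes> \<one> \<otimes> k' \<otimes> (c \<otimes> u))" using Pf[of \<one> k' "c \<otimes> u"] A_one k' by blast
      moreover have "a \<otimes> k \<otimes> u = a \<otimes> \<one> \<otimes> k' \<otimes> (c \<otimes> u)" using car by (simp add: kc m_ac)
      ultimately show False using P(1) by simp
    qed
  qed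
qed

text \<open>The basic neighbourhoods are so large that a Cauchy filter cannot escape from words of every length.
  Suppose that it avoids \<open>a \<otimes> words n \<otimes> nbhd (f n)\<close> for each \<open>n\<close>. There is one function \<open>g\<close> with
  \<open>nbhd g \<subseteq> words n \<otimes> nbhd (f (2 * n))\<close> for all \<open>n\<close>: split off the first \<open>n\<close> factors. The Cauchy
  filter contains a subset of a translate \<open>y \<otimes> nbhd g\<close> with \<open>y \<in> a \<otimes> words n\<close>, which lies in the
  avoided set for \<open>2 * n\<close>.\<close>

lemma cauchy_adheres_words:
  assumes F: "cauchy_filter_group G nbhd_topology F"
  shows "\<exists>a\<in>carrier G. \<exists>n. adheres F ((\<lambda>k. a \<otimes> k) ` words n)"
proof -
  obtain P0 Q0 where PQ0: "eventually P0 F" "eventually Q0 F"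
    "\<And>x y. P0 x \<Longrightarrow> Q0 y \<Longrightarrow> x \<otimes> inv y \<in> nbhd (\<lambda>_. 0)"
    using cauchy_nbhdE[OF F] by blast
  note carF = cauchy_carrier[OF F]
  obtain a where a: "Q0 a" "a \<in> carrier G"
    using eventually_happens'[OF carF(2) eventually_conj[OF PQ0(2) carF(1)]] by blast
  have "\<exists>n. adheres F ((\<lambda>k. a \<otimes> k) ` words n)"
  proof (rule ccontr)
    assume "\<not> ?thesis"
    then have "\<forall>n. \<exists>P f. eventually P F \<and> (\<forall>k\<in>words n. \<forall>u\<in>nbhd f. \<not> P (a \<otimes> k \<otimes> u))"
      unfolding adheres_def by auto
    then obtain Pn f where ev: "\<And>n. eventually (Pn n) F"
      and Pf: "\<And>n k u. k \<in> words n \<Longrightarrow> u \<in> nbhd (f n) \<Longrightarrow> \<not> Pn n (a \<otimes> k \<otimes> u)"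
      by metis
    \<comment> \<open>The maximum over \<open>i \<le> j\<close> makes \<open>g (n + j)\<close> dominate \<open>f (2 * n) j\<close>, where the index has
      dropped by \<open>n\<close> because \<open>n\<close> factors are split off.\<close>
    define g where "g = (\<lambda>j. Max ((\<lambda>(n, i). f (2 * n) i) ` ({..j} \<times> {..j})))"
    have split: "\<exists>k\<in>words n. \<exists>v\<in>nbhd (f (2 * n)). u = k \<otimes> v" if u: "u \<in> nbhd g" for u n
    proof -
      obtain m where "u \<in> prefix_product (\<lambda>j. A (g j)) m" using u unfolding nbhd_def by blast
      moreover have "prefix_product (\<lambda>j. A (g j)) m \<subseteq> prefix_product (\<lambda>j. A (g j)) (n + m)"
        by (rule prefix_product_subset_later; simp add: A_closed A_one)
      ultimately have "u \<in> prefix_product (\<lambda>j. A (g j)) n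
          <#> prefix_product (\<lambda>j. A (g (n + j))) m"
        using prefix_product_append[of "\<lambda>j. A (g j)" n m] A_closed by blast
      moreover have "prefix_product (\<lambda>j. A (g j)) n \<subseteq> words n"
        by (intro prefix_product_mono A_anti) simp
      moreover have "f (2 * n) j \<le> g (n + j)" for j
        unfolding g_def by (rule Max_ge) (auto intro!: image_eqI[of _ _ "(n, j)"])
      then have "prefix_product (\<lambda>j. A (g (n + j))) m \<subseteq> nbhd (f (2 * n))"
        unfolding nbhd_def using prefix_product_mono[of m "\<lambda>j. A (g (n + j))" "\<lambda>j. A (f (2 * n) j)"]
          A_anti by blast
      ultimately show ?thesis unfolding mem_set_mult by blast
    qed
    obtain P Q where PQ: "eventually P F" "eventually Q F"
      "\<And>x y. P x \<Longrightarrow> Q y \<Longrightarrow> x \<otimes> inv y \<in> nbhd g"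
      using cauchy_nbhdE[OF F] by blast
    have "eventually (\<lambda>y. Q y \<and> P0 y \<and> y \<in> carrier G) F"
      using PQ(2) PQ0(1) carF(1) by (intro eventually_conj)
    then obtain y where y: "Q y" "P0 y" "y \<in> carrier G"
      using eventually_happens'[OF carF(2)] by blast
    then have "y \<otimes> inv a \<in> nbhd (\<lambda>_. 0)" using PQ0(3) a by blast
    then obtain n where n: "y \<otimes> inv a \<in> words n" unfolding nbhd_def by blast
    have "eventually (\<lambda>x. P x \<and> Pn (2 * n) x \<and> x \<in> carrier G) F"
      using PQ(1) ev carF(1) by (intro eventually_conj)
    then obtain x where x: "P x" "Pn (2 * n) x" "x \<in> carrier G"
      using eventually_happens'[OF carF(2)] by blast
    have "x \<otimes> inv y \<in> nbhd g" using PQ(3) x y by blast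
    then obtain k v where k: "k \<in> words n" and v: "v \<in> nbhd (f (2 * n))"
      and kv: "x \<otimes> inv y = k \<otimes> v" using split by blast
    have kc: "k \<in> carrier G" "v \<in> carrier G" using k v by auto
    have "y \<otimes> inv a \<otimes> k \<in> words n <#> words n"
      using n k unfolding mem_set_mult by blast
    then have "y \<otimes> inv a \<otimes> k \<in> words (2 * n)"
      using prefix_product_append[of "\<lambda>_. A 0" n n] A_closed by (simp add: mult_2)
    then have "\<not> Pn (2 * n) (a \<otimes> (y \<otimes> inv a \<otimes> k) \<otimes> v)" using Pf v by blast
    moreover have "a \<otimes> (y \<otimes> inv a \<otimes> k) \<otimes> v = x"
    proof -
      have "a \<otimes> (y \<otimes> b \<otimes> k) \<otimes> v = (a \<otimes> b) \<otimes> ((k \<otimes> v) \<otimes> y)" if "b \<in> carrier G" for b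
        using a(2) y(3) kc that by (simp add: m_ac)
      from this[of "inv a"]
      have "a \<otimes> (y \<otimes> inv a \<otimes> k) \<otimes> v = (a \<otimes> inv a) \<otimes> ((k \<otimes> v) \<otimes> y)"
        using a(2) by blast
      also have "\<dots> = x" using a(2) x(3) y(3) kc by (simp flip: kv add: m_assoc)
      finally show ?thesis .
    qed
    ultimately show False using x(2) by simp
  qed
  then show ?thesis using a by blast
qed

lemma complete_nbhd_topology: "complete_group_topology G nbhd_topology"
  unfolding complete_group_topology_def
  using cauchy_adheres_words adheres_words_point cauchy_adheres_limit by meson

end

section \<open>Characters of abelian groups\<close>

context comm_group
begin

lemma character_norm [simp]:
  "\<phi> \<in> hom G circle_group \<Longrightarrow> x \<in> carrier G \<Longrightarrow> norm (\<phi> x) = 1"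
  using hom_in_carrier[of \<phi> G circle_group x] by (simp add: circle_group_def)

lemma character_mult:
  "\<phi> \<in> hom G circle_group \<Longrightarrow> x \<in> carrier G \<Longrightarrow> y \<in> carrier G \<Longrightarrow> \<phi> (x \<otimes> y) = \<phi> x * \<phi> y"
  using hom_mult[of \<phi> G circle_group x y] by (simp add: circle_group_def)

lemma character_one [simp]:
  assumes "\<phi> \<in> hom G circle_group"
  shows "\<phi> \<one> = 1"
proof -
  have "\<phi> \<one> = \<phi> \<one> * \<phi> \<one>" using character_mult[OF assms, of \<one> \<one>] by simp
  moreover have "\<phi> \<one> \<noteq> 0" using character_norm[OF assms, of \<one>] by auto
  ultimately show ?thesis by simp
qed

lemma character_inv:
  assumes "\<phi> \<in> hom G circle_group" "x \<in> carrier G"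
  shows "\<phi> (inv x) = inverse (\<phi> x)"
proof -
  have "\<phi> x * \<phi> (inv x) = 1" using character_mult[OF assms(1), of x "inv x"] assms by simp
  then show ?thesis by (simp add: inverse_unique)
qed

lemma character_pow:
  assumes "\<phi> \<in> hom G circle_group" "x \<in> carrier G"
  shows "\<phi> (x [^] (n::nat)) = \<phi> x ^ n"
  by (induction n) (use assms in \<open>simp_all add: character_mult mult.commute\<close>)

lemma character_dist_mult:
  assumes "\<phi> \<in> hom G circle_group" "x \<in> carrier G" "y \<in> carrier G"
  shows "norm (\<phi> (x \<otimes> y) - 1) \<le> norm (\<phi> x - 1) + norm (\<phi> y - 1)"
proof -
  have "\<phi> (x \<otimes> y) - 1 = \<phi> x * (\<phi> y - 1) + (\<phi> x - 1)"
    using assms by (simp add: character_mult algebra_simps)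
  also have "norm \<dots> \<le> norm (\<phi> x * (\<phi> y - 1)) + norm (\<phi> x - 1)" by (rule norm_triangle_ineq)
  also have "\<dots> = norm (\<phi> y - 1) + norm (\<phi> x - 1)" using assms by (simp add: norm_mult)
  finally show ?thesis by simp
qed

lemma character_dist_inv:
  assumes "\<phi> \<in> hom G circle_group" "x \<in> carrier G"
  shows "norm (\<phi> (inv x) - 1) = norm (\<phi> x - 1)"
proof -
  have n: "norm (\<phi> x) = 1" using assms by simp
  then have "\<phi> x \<noteq> 0" by auto
  then have "\<phi> (inv x) - 1 = - ((\<phi> x - 1) / \<phi> x)"
    using assms by (simp add: character_inv divide_simps)
  then show ?thesis using n by (simp add: norm_divide)
qed

lemma character_dist_pow:
  fixes n :: nat
  assumes "\<phi> \<in> hom G circle_group" "x \<in> carrier G"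
  shows "norm (\<phi> (x [^] n) - 1) \<le> real n * norm (\<phi> x - 1)"
proof (induction n)
  case (Suc n)
  have "norm (\<phi> (x [^] Suc n) - 1) \<le> norm (\<phi> (x [^] n) - 1) + norm (\<phi> x - 1)"
    using character_dist_mult[of \<phi> "x [^] n" x] assms by simp
  then show ?case using Suc by (simp add: algebra_simps)
qed (use assms in simp)

lemma character_dist_finprod:
  fixes n :: nat
  assumes "\<phi> \<in> hom G circle_group" "\<And>i. i < n \<Longrightarrow> e i \<in> carrier G"
  shows "norm (\<phi> (finprod G e {..<n}) - 1) \<le> (\<Sum>i<n. norm (\<phi> (e i) - 1))"
  using assms(2)
proof (induction n)
  case (Suc n)
  have e: "e \<in> {..<n} \<rightarrow> carrier G" "e n \<in> carrier G" using Suc.prems by auto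
  then have "finprod G e {..<Suc n} = e n \<otimes> finprod G e {..<n}"
    by (simp add: lessThan_Suc)
  then show ?case
    using character_dist_mult[OF assms(1) e(2) finprod_closed[OF e(1)]] Suc by simp
qed (use assms in simp)

end

text \<open>A \<open>k\<close>-th root different from \<open>1\<close> is available even for \<open>w = 1\<close>; it is the value at a new element
  when a character is extended so as to be nontrivial there.\<close>

lemma root_of_unit_complex:
  fixes w :: complex
  assumes "norm w = 1" and "k \<ge> 2"
  shows "\<exists>\<zeta>. norm \<zeta> = 1 \<and> \<zeta> \<noteq> 1 \<and> \<zeta> ^ k = w"
proof (cases "w = 1")
  case True
  define z where "z = cis (2 * pi / k)"
  have "real k * (2 * pi / real k) = 2 * pi" using assms(2) by simp
  then have "z ^ k = 1" unfolding z_def Complex.DeMoivre by (simp only: cis_2pi)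
  moreover have "z \<noteq> 1"
  proof
    assume "z = 1"
    then have "cos (2 * pi / k) = 1" by (simp add: z_def complex_eq_iff)
    moreover have "0 < 2 * pi / k" "2 * pi / k \<le> pi" using assms(2) by (auto simp: field_simps)
    ultimately show False using cos_monotone_0_pi[of 0 "2 * pi / k"] by simp
  qed
  ultimately show ?thesis using True by (intro exI[of _ z]) (simp add: z_def)
next
  case False
  define z where "z = cis (Arg w / k)"
  have "w \<noteq> 0" using assms(1) by auto
  then have "z ^ k = w" using assms cis_Arg[of w] by (auto simp: z_def Complex.DeMoivre sgn_eq)
  moreover have "z \<noteq> 1" using False \<open>z ^ k = w\<close> by auto
  ultimately show ?thesis by (intro exI[of _ z]) (simp add: z_def)
qed

context comm_group
begin

text \<open>The graph of a circle-valued homomorphism on a subgroup, described as a relation so that extension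
  is inclusion and the union of a chain is again an upper bound. The last clause makes the
  relation single-valued.\<close>

definition character_graph :: "('a \<times> complex) set \<Rightarrow> bool" where
  "character_graph R \<longleftrightarrow>
    R \<subseteq> carrier G \<times> sphere 0 1 \<and> (\<one>, 1) \<in> R \<and>
    (\<forall>x z y w. (x, z) \<in> R \<longrightarrow> (y, w) \<in> R \<longrightarrow> (x \<otimes> y, z * w) \<in> R) \<and>
    (\<forall>x z. (x, z) \<in> R \<longrightarrow> (inv x, inverse z) \<in> R) \<and>
    (\<forall>z. (\<one>, z) \<in> R \<longrightarrow> z = 1)"

lemma character_graph_unique:
  assumes R: "character_graph R" and "(x, z) \<in> R" "(x, w) \<in> R"
  shows "z = w"
proof -
  have x: "x \<in> carrier G" and w: "norm w = 1" using assms unfolding character_graph_def by auto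
  have "(x \<otimes> inv x, z * inverse w) \<in> R" using assms unfolding character_graph_def by blast
  then have "(\<one>, z * inverse w) \<in> R" using x by simp
  then have "z * inverse w = 1" using R unfolding character_graph_def by blast
  moreover have "w \<noteq> 0" using w by auto
  ultimately show ?thesis by (simp add: field_simps)
qed

lemma character_graph_power:
  assumes R: "character_graph R" and xz: "(x, z) \<in> R"
  shows "(x [^] (m::int), z powi m) \<in> R"
proof -
  have nat: "(x [^] (n::nat), z ^ n) \<in> R" for n
  proof (induction n)
    case 0
    then show ?case using R by (simp add: character_graph_def)
  next
    case (Suc n)
    then have "(x [^] n \<otimes> x, z ^ n * z) \<in> R" using R xz unfolding character_graph_def by blast
    then show ?case by (simp add: mult.commute)
  qed
  have x: "x \<in> carrier G" using assms unfolding character_graph_def by auto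
  show ?thesis
  proof (cases m rule: int_cases2)
    case (nonneg n)
    then show ?thesis using nat[of n] by (simp add: int_pow_int)
  next
    case (nonpos n)
    have "(inv (x [^] n), inverse (z ^ n)) \<in> R"
      using nat[of n] R unfolding character_graph_def by blast
    then show ?thesis using nonpos x by (simp add: int_pow_neg_int power_int_minus)
  qed
qed

text \<open>Let \<open>k\<close> be the least positive exponent for which \<open>y [^] k\<close> lies in the domain. A value \<open>\<zeta>\<close> at \<open>y\<close> is
  admissible if \<open>\<zeta> ^ k\<close> is the prescribed value at \<open>y [^] k\<close>, since the exponents \<open>m\<close> for which
  \<open>y [^] m\<close> lies in the domain are the multiples of \<open>k\<close>. If there is no such \<open>k\<close>, then any value
  will do. In both cases a value different from \<open>1\<close> is possible.\<close>

lemma character_graph_extend: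
  assumes R: "character_graph R" and y: "y \<in> carrier G" "y \<notin> fst ` R"
  shows "\<exists>R' \<zeta>. character_graph R' \<and> R \<subseteq> R' \<and> (y, \<zeta>) \<in> R' \<and> \<zeta> \<noteq> 1"
proof -
  have "\<exists>\<zeta>. norm \<zeta> = 1 \<and> \<zeta> \<noteq> 1 \<and> (\<forall>m z. (y [^] (m::int), z) \<in> R \<longrightarrow> z = \<zeta> powi m)"
  proof (cases "\<exists>k::nat. k > 0 \<and> y [^] k \<in> fst ` R")
    case False
    have "m = 0" if "(y [^] (m::int), z) \<in> R" for m z
    proof (rule ccontr)
      assume "m \<noteq> 0"
      have "y [^] nat \<bar>m\<bar> \<in> fst ` R"
      proof (cases m rule: int_cases2)
        case (nonneg n)
        then show ?thesis using that by (force simp: int_pow_int image_iff)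
      next
        case (nonpos n)
        have "(inv (y [^] m), inverse z) \<in> R" using that R unfolding character_graph_def by blast
        then show ?thesis using nonpos y(1) by (force simp: int_pow_neg_int image_iff)
      qed
      moreover have "nat \<bar>m\<bar> > 0" using \<open>m \<noteq> 0\<close> by simp
      ultimately show False using False by blast
    qed
    then have "\<forall>m z. (y [^] (m::int), z) \<in> R \<longrightarrow> z = (-1) powi m"
      using R unfolding character_graph_def by fastforce
    then show ?thesis by (intro exI[of _ "-1"]) auto
  next
    case True
    define k where "k = (LEAST k::nat. k > 0 \<and> y [^] k \<in> fst ` R)"
    have k: "k > 0" "y [^] k \<in> fst ` R" using LeastI_ex[OF True] unfolding k_def by auto
    have kmin: "\<not> (j > 0 \<and> y [^] j \<in> fst ` R)" if "j < k" for j :: nat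
      using not_less_Least[of j] that unfolding k_def by blast
    have "k \<noteq> 1"
    proof
      assume "k = 1"
      then show False using k(2) y by simp
    qed
    then have k2: "k \<ge> 2" using k by auto
    obtain w where w: "(y [^] k, w) \<in> R" using k by force
    then have "norm w = 1" using R unfolding character_graph_def by auto
    then obtain \<zeta> where \<zeta>: "norm \<zeta> = 1" "\<zeta> \<noteq> 1" "\<zeta> ^ k = w"
      using root_of_unit_complex[OF _ k2] by blast
    have "z = \<zeta> powi m" if m: "(y [^] (m::int), z) \<in> R" for m z
    proof -
      define q r where "q = m div int k" and "r = nat (m mod int k)"
      have mqr: "m = int k * q + int r" using k(1) by (simp add: q_def r_def)
      have rk: "r < k" using k(1) by (simp add: r_def nat_less_iff)
      have pw: "((y [^] k) [^] q, w powi q) \<in> R" by (rule character_graph_power[OF R w])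
      have ykq: "(y [^] k) [^] q = y [^] (int k * q)"
        using y(1) int_pow_pow[of y "int k" q] by (simp add: int_pow_int)
      have "(y [^] m \<otimes> inv ((y [^] k) [^] q), z * inverse (w powi q)) \<in> R"
        using m pw R unfolding character_graph_def by blast
      moreover have "y [^] m \<otimes> inv ((y [^] k) [^] q) = y [^] r"
        using y(1) int_pow_diff[of y m "int k * q"] mqr by (simp add: ykq int_pow_int)
      ultimately have r: "(y [^] r, z * inverse (w powi q)) \<in> R" by simp
      then have "r = 0" using kmin[OF rk] by force
      then have meq: "m = int k * q" using mqr by simp
      then have "(y [^] m, w powi q) \<in> R" using pw ykq by simp
      then have "z = w powi q" using character_graph_unique[OF R m] by blast
      also have "\<dots> = \<zeta> powi m" using \<zeta>(3) by (simp add: meq power_int_mult)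
      finally show ?thesis .
    qed
    then show ?thesis using \<zeta> by blast
  qed
  then obtain \<zeta> where \<zeta>: "norm \<zeta> = 1" "\<zeta> \<noteq> 1"
    and comp: "\<And>m z. (y [^] (m::int), z) \<in> R \<Longrightarrow> z = \<zeta> powi m" by blast
  have z0: "\<zeta> \<noteq> 0" using \<zeta> by auto
  define R' where "R' = {(x \<otimes> y [^] m, z * \<zeta> powi m) | x z (m::int). (x, z) \<in> R}"
  have R'I: "(x \<otimes> y [^] (m::int), z * \<zeta> powi m) \<in> R'" if "(x, z) \<in> R" for x z m
    using that unfolding R'_def by blast
  have car: "x \<in> carrier G" "norm z = 1" if "(x, z) \<in> R" for x z
    using that R unfolding character_graph_def by auto
  have Rone: "(\<one>, 1) \<in> R" using R unfolding character_graph_def by blast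
  have "character_graph R'"
    unfolding character_graph_def
  proof (intro conjI allI impI)
    show "R' \<subseteq> carrier G \<times> sphere 0 1"
      using car y \<zeta>(1) by (auto simp: R'_def norm_mult norm_power_int)
    show "(\<one>, 1) \<in> R'" using R'I[OF Rone, of 0] y by simp
  next
    fix a s b t assume "(a, s) \<in> R'" "(b, t) \<in> R'"
    then obtain x z m x' z' m' where *: "(x, z) \<in> R" "(x', z') \<in> R"
      "a = x \<otimes> y [^] (m::int)" "s = z * \<zeta> powi m" "b = x' \<otimes> y [^] (m'::int)" "t = z' * \<zeta> powi m'"
      unfolding R'_def by blast
    then have "(x \<otimes> x', z * z') \<in> R" using R unfolding character_graph_def by blast
    from R'I[OF this, of "m + m'"] show "(a \<otimes> b, s * t) \<in> R'"
      using * car[OF *(1)] car[OF *(2)] y z0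
      by (simp add: int_pow_mult m_ac power_int_add mult_ac)
  next
    fix a s assume "(a, s) \<in> R'"
    then obtain x z m where *: "(x, z) \<in> R" "a = x \<otimes> y [^] (m::int)" "s = z * \<zeta> powi m"
      unfolding R'_def by blast
    then have "(inv x, inverse z) \<in> R" using R unfolding character_graph_def by blast
    from R'I[OF this, of "- m"] show "(inv a, inverse s) \<in> R'"
      using * car[OF *(1)] y z0 by (simp add: inv_mult int_pow_neg power_int_minus)
  next
    fix s assume "(\<one>, s) \<in> R'"
    then obtain x z m where *: "(x, z) \<in> R" "\<one> = x \<otimes> y [^] (m::int)" "s = z * \<zeta> powi m"
      unfolding R'_def by blast
    have "inv x = y [^] m" using * car[OF *(1)] y(1)
      by (metis inv_closed inv_equality inv_inv int_pow_closed m_comm)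
    moreover have "(inv x, inverse z) \<in> R" using *(1) R unfolding character_graph_def by blast
    ultimately have "inverse z = \<zeta> powi m" using comp by simp
    then show "s = 1" using *(3) car[OF *(1)] by (metis norm_zero right_inverse zero_neq_one)
  qed
  moreover have "R \<subseteq> R'"
  proof
    fix p assume "p \<in> R"
    then show "p \<in> R'" using R'I[of "fst p" "snd p" 0] car[of "fst p" "snd p"] by simp
  qed
  moreover have "(y, \<zeta>) \<in> R'" using R'I[OF Rone, of 1] y by simp
  ultimately show ?thesis using \<zeta>(2) by blast
qed

lemma character_graph_Union:
  assumes "C \<noteq> {}" "\<And>R. R \<in> C \<Longrightarrow> character_graph R" "subset.chain UNIV C"
  shows "character_graph (\<Union>C)"
proof -
  have two: "\<exists>R\<in>C. p \<in> R \<and> q \<in> R" if pq: "p \<in> \<Union>C" "q \<in> \<Union>C" for p q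
  proof -
    obtain R S where RS: "R \<in> C" "S \<in> C" "p \<in> R" "q \<in> S" using pq by blast
    then have "R \<subseteq> S \<or> S \<subseteq> R" using assms(3) unfolding subset.chain_def by blast
    then show ?thesis using RS by blast
  qed
  show ?thesis
    unfolding character_graph_def
  proof (intro conjI allI impI)
    show "\<Union>C \<subseteq> carrier G \<times> sphere 0 1" using assms(2) unfolding character_graph_def by blast
    show "(\<one>, 1) \<in> \<Union>C" using assms(1,2) unfolding character_graph_def by blast
    show "(x \<otimes> y, z * w) \<in> \<Union>C" if "(x, z) \<in> \<Union>C" "(y, w) \<in> \<Union>C" for x z y w
      using two[OF that] assms(2) unfolding character_graph_def by blast
    show "(inv x, inverse z) \<in> \<Union>C" if "(x, z) \<in> \<Union>C" for x z
      using that assms(2) unfolding character_graph_def by blast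
    show "z = 1" if "(\<one>, z) \<in> \<Union>C" for z
      using that assms(2) unfolding character_graph_def by blast
  qed
qed

text \<open>Extend the trivial character of \<open>N\<close> to \<open>x\<close> with a value different from \<open>1\<close>, and then to the whole
  group by Zorn's lemma.\<close>

lemma character_separating_subgroup:
  assumes N: "subgroup N G" and x: "x \<in> carrier G" "x \<notin> N"
  shows "\<exists>\<phi>\<in>hom G circle_group. (\<forall>a\<in>N. \<phi> a = 1) \<and> \<phi> x \<noteq> 1"
proof -
  interpret N: subgroup N G by fact
  have "character_graph (N \<times> {1})"
    unfolding character_graph_def using N.subset by auto
  moreover have "x \<notin> fst ` (N \<times> {1::complex})" using x by auto
  ultimately obtain R0 \<zeta> where R0: "character_graph R0" "N \<times> {1} \<subseteq> R0" "(x, \<zeta>) \<in> R0" "\<zeta> \<noteq> 1"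
    using character_graph_extend x(1) by blast
  let ?\<R> = "{R. character_graph R \<and> R0 \<subseteq> R}"
  have "\<exists>M\<in>?\<R>. \<forall>X\<in>?\<R>. M \<subseteq> X \<longrightarrow> X = M"
  proof (rule subset_Zorn_nonempty)
    show "?\<R> \<noteq> {}" using R0 by blast
    fix C assume C: "C \<noteq> {}" "subset.chain ?\<R> C"
    then have "C \<subseteq> ?\<R>" "subset.chain UNIV C" unfolding subset.chain_def by auto
    then show "\<Union>C \<in> ?\<R>" using character_graph_Union[OF C(1)] C(1) by blast
  qed
  then obtain M where M_in: "M \<in> ?\<R>" and M_max: "\<forall>X\<in>?\<R>. M \<subseteq> X \<longrightarrow> X = M" ..
  have M: "character_graph M" "R0 \<subseteq> M" using M_in by auto
  have max: "X = M" if "character_graph X" "M \<subseteq> X" for X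
    using M_max M(2) that by auto
  have total: "\<exists>z. (y, z) \<in> M" if yG: "y \<in> carrier G" for y
  proof (rule ccontr)
    assume "\<not> ?thesis"
    then have "y \<notin> fst ` M" by force
    then obtain X z where X: "character_graph X" "M \<subseteq> X" "(y, z) \<in> X"
      using character_graph_extend[OF M(1) yG] by blast
    then have "(y, z) \<in> M" using max[OF X(1,2)] by simp
    then show False using \<open>y \<notin> fst ` M\<close> by force
  qed
  define \<phi> where "\<phi> = (\<lambda>y. SOME z. (y, z) \<in> M)"
  have \<phi>: "(y, \<phi> y) \<in> M" if "y \<in> carrier G" for y
    unfolding \<phi>_def using someI_ex[OF total[OF that]] .
  have eq: "\<phi> y = z" if "(y, z) \<in> M" for y z
    using character_graph_unique[OF M(1) \<phi> that] M(1) that unfolding character_graph_def by blast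
  have "\<phi> \<in> hom G circle_group"
  proof (rule homI)
    fix y assume "y \<in> carrier G"
    then have "(y, \<phi> y) \<in> carrier G \<times> sphere 0 1"
      using \<phi> M(1) unfolding character_graph_def by blast
    then show "\<phi> y \<in> carrier circle_group" by (simp add: circle_group_def)
  next
    fix y z assume "y \<in> carrier G" "z \<in> carrier G"
    then have "(y \<otimes> z, \<phi> y * \<phi> z) \<in> M" using \<phi> M(1) unfolding character_graph_def by blast
    then show "\<phi> (y \<otimes> z) = \<phi> y \<otimes>\<^bsub>circle_group\<^esub> \<phi> z" using eq by (simp add: circle_group_def)
  qed
  moreover have "\<forall>a\<in>N. \<phi> a = 1" using eq R0(2) M(2) by blast
  moreover have "\<phi> x \<noteq> 1" using eq R0 M(2) by blast
  ultimately show ?thesis by blast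
qed

end

section \<open>Continuous characters\<close>

context shrinking_sets
begin

lemma character_small_on_prefix_product:
  assumes \<phi>: "\<phi> \<in> hom G circle_group"
    and small: "\<And>j a. a \<in> A (f j) \<Longrightarrow> norm (\<phi> a - 1) \<le> \<epsilon> / 2 ^ Suc j"
    and x: "x \<in> prefix_product (\<lambda>j. A (f j)) k"
  shows "norm (\<phi> x - 1) \<le> \<epsilon> * (1 - 1 / 2 ^ k)"
  using x
proof (induction k arbitrary: x)
  case 0
  then show ?case using \<phi> by simp
next
  case (Suc k)
  then obtain a b where ab: "a \<in> prefix_product (\<lambda>j. A (f j)) k" "b \<in> A (f k)" "x = a \<otimes> b"
    by (auto simp: mem_set_mult)
  have "prefix_product (\<lambda>j. A (f j)) k \<subseteq> carrier G" by (intro prefix_product_closed A_closed)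
  then have "norm (\<phi> x - 1) \<le> norm (\<phi> a - 1) + norm (\<phi> b - 1)"
    using character_dist_mult[OF \<phi>] ab by auto
  also have "\<dots> \<le> \<epsilon> * (1 - 1 / 2 ^ k) + \<epsilon> / 2 ^ Suc k"
    using Suc.IH[OF ab(1)] small[OF ab(2)] by simp
  also have "\<dots> = \<epsilon> * (1 - 1 / 2 ^ Suc k)" by (simp add: field_simps)
  finally show ?case .
qed

text \<open>If \<open>\<phi>\<close> tends to \<open>1\<close> along the \<open>A n\<close>, choose \<open>f\<close> so that the \<open>j\<close>-th factor of an element of
  \<open>nbhd f\<close> contributes an error of at most \<open>\<epsilon> / 2 ^ Suc j\<close>; the errors of a product add up to less
  than \<open>\<epsilon>\<close>, however long it is.\<close>

lemma continuous_character_iff: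
  assumes \<phi>: "\<phi> \<in> hom G circle_group"
  shows "continuous_map nbhd_topology (top_of_set (sphere 0 1)) \<phi> \<longleftrightarrow>
    (\<forall>\<epsilon>>0. \<exists>n. \<forall>a\<in>A n. norm (\<phi> a - 1) < \<epsilon>)"
proof
  assume "continuous_map nbhd_topology (top_of_set (sphere 0 1)) \<phi>"
  then have cont: "continuous_map nbhd_topology euclidean \<phi>"
    by (simp add: continuous_map_in_subtopology)
  show "\<forall>\<epsilon>>0. \<exists>n. \<forall>a\<in>A n. norm (\<phi> a - 1) < \<epsilon>"
  proof (intro allI impI)
    fix \<epsilon> :: real assume "\<epsilon> > 0"
    have "openin nbhd_topology {x \<in> topspace nbhd_topology. \<phi> x \<in> ball 1 \<epsilon>}"
      using cont by (rule openin_continuous_map_preimage) simp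
    moreover have "\<one> \<in> {x \<in> topspace nbhd_topology. \<phi> x \<in> ball 1 \<epsilon>}"
      using \<phi> \<open>\<epsilon> > 0\<close> by simp
    ultimately obtain f where
      "\<forall>u\<in>nbhd f. \<one> \<otimes> u \<in> {x \<in> topspace nbhd_topology. \<phi> x \<in> ball 1 \<epsilon>}"
      unfolding openin_nbhd_topology by blast
    then have "\<forall>a\<in>A (f 0). norm (\<phi> a - 1) < \<epsilon>"
      using A_subset_nbhd[of f] by (force simp: dist_norm norm_minus_commute)
    then show "\<exists>n. \<forall>a\<in>A n. norm (\<phi> a - 1) < \<epsilon>" by blast
  qed
next
  assume small: "\<forall>\<epsilon>>0. \<exists>n. \<forall>a\<in>A n. norm (\<phi> a - 1) < \<epsilon>"
  have "continuous_map nbhd_topology euclidean \<phi>"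
    unfolding continuous_map_def
  proof (intro conjI allI impI)
    fix V :: "complex set" assume V: "openin euclidean V"
    have "\<exists>f. \<forall>u\<in>nbhd f. x \<otimes> u \<in> {x \<in> carrier G. \<phi> x \<in> V}"
      if x: "x \<in> carrier G" "\<phi> x \<in> V" for x
    proof -
      obtain \<epsilon> where \<epsilon>: "\<epsilon> > 0" "ball (\<phi> x) \<epsilon> \<subseteq> V" using V x by (auto simp: open_contains_ball)
      have "\<forall>j. \<exists>n. \<forall>a\<in>A n. norm (\<phi> a - 1) < \<epsilon> / 2 ^ Suc j" using small \<epsilon>(1) by simp
      then obtain f where f: "\<And>j a. a \<in> A (f j) \<Longrightarrow> norm (\<phi> a - 1) < \<epsilon> / 2 ^ Suc j" by metis
      have "x \<otimes> u \<in> {x \<in> carrier G. \<phi> x \<in> V}" if u: "u \<in> nbhd f" for u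
      proof -
        obtain k where "u \<in> prefix_product (\<lambda>j. A (f j)) k" using u unfolding nbhd_def by blast
        then have "norm (\<phi> u - 1) \<le> \<epsilon> * (1 - 1 / 2 ^ k)"
          by (rule character_small_on_prefix_product[OF \<phi>, rotated]) (use f less_imp_le in blast)
        also have "\<dots> < \<epsilon>" using \<epsilon>(1) by (simp add: field_simps)
        finally have less: "norm (\<phi> u - 1) < \<epsilon>" .
        have uc: "u \<in> carrier G" using u by simp
        have "\<phi> (x \<otimes> u) - \<phi> x = \<phi> x * (\<phi> u - 1)"
          using \<phi> x uc by (simp add: character_mult algebra_simps)
        then have "norm (\<phi> (x \<otimes> u) - \<phi> x) < \<epsilon>" using less \<phi> x by (simp add: norm_mult)
        then have "\<phi> (x \<otimes> u) \<in> ball (\<phi> x) \<epsilon>" by (simp add: dist_norm norm_minus_commute)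
        then show ?thesis using \<epsilon>(2) x uc by auto
      qed
      then show ?thesis by blast
    qed
    then show "openin nbhd_topology {x \<in> topspace nbhd_topology. \<phi> x \<in> V}"
      unfolding openin_nbhd_topology topspace_nbhd_topology by blast
  qed simp
  then show "continuous_map nbhd_topology (top_of_set (sphere 0 1)) \<phi>"
    using \<phi> by (simp add: continuous_map_in_subtopology image_subset_iff)
qed

end

section \<open>Elements whose small powers avoid a finite set\<close>

context comm_group
begin

text \<open>The form in which unboundedness enters the construction.\<close>

definition power_avoiding :: "'a set \<Rightarrow> bool" where
  "power_avoiding C \<longleftrightarrow> C \<subseteq> carrier G \<and>
    (\<forall>S q. finite S \<longrightarrow> S \<subseteq> carrier G \<longrightarrow> (\<exists>e\<in>C. \<forall>m::nat. 0 < m \<longrightarrow> m \<le> q \<longrightarrow> e [^] m \<notin> S))"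

text \<open>For each exponent \<open>m\<close> and each \<open>s \<in> S\<close> at most one \<open>k\<close> satisfies \<open>(g [^] k) [^] m = s\<close>.\<close>

lemma power_avoiding_infinite_order:
  assumes g: "g \<in> carrier G" "ord g = 0"
  shows "power_avoiding (range (\<lambda>k::nat. g [^] k))"
  unfolding power_avoiding_def
proof (intro conjI allI impI)
  show "range (\<lambda>k::nat. g [^] k) \<subseteq> carrier G" using g by auto
  fix S q assume S: "finite S" "S \<subseteq> carrier G"
  define B where "B m = {k::nat. (g [^] k) [^] m \<in> S}" for m :: nat
  have "finite (B m)" if "m > 0" for m
  proof -
    have "inj (\<lambda>k::nat. (g [^] k) [^] m)"
    proof (rule injI)
      fix k l :: nat assume "(g [^] k) [^] m = (g [^] l) [^] m"
      then have "g [^] int (k * m) = g [^] int (l * m)" using g by (simp only: int_pow_int nat_pow_pow)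
      then have "int (l * m) - int (k * m) = 0" using g by (simp only: int_pow_eq) simp
      then show "k = l" using that by simp
    qed
    then show ?thesis using finite_vimageI[OF S(1)] by (simp add: B_def vimage_def)
  qed
  then have "finite (\<Union>m\<in>{1..q}. B m)" by simp
  then obtain k where "k \<notin> (\<Union>m\<in>{1..q}. B m)" using ex_new_if_finite infinite_UNIV_nat by blast
  then have "\<forall>m. 0 < m \<longrightarrow> m \<le> q \<longrightarrow> (g [^] k) [^] m \<notin> S" by (auto simp: B_def)
  then show "\<exists>e\<in>range (\<lambda>k::nat. g [^] k). \<forall>m::nat. 0 < m \<longrightarrow> m \<le> q \<longrightarrow> e [^] m \<notin> S" by blast
qed

text \<open>If \<open>L\<close> is the product of the orders of the elements of \<open>S\<close>, then an element with a power
  \<open>e [^] m\<close> in \<open>S\<close> has order at most \<open>m * L\<close>.\<close>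

lemma power_avoiding_unbounded_orders:
  assumes tor: "\<And>x. x \<in> carrier G \<Longrightarrow> ord x \<noteq> 0"
    and d: "\<And>n::nat. d n \<in> carrier G" "\<And>n. ord (d n) \<ge> n"
  shows "power_avoiding (range d)"
  unfolding power_avoiding_def
proof (intro conjI allI impI)
  show "range d \<subseteq> carrier G" using d by auto
  fix S q assume S: "finite S" "S \<subseteq> carrier G"
  define L where "L = (\<Prod>s\<in>S. ord s)"
  have L: "L > 0" using S tor by (auto simp: L_def prod_pos_nat_iff)
  let ?e = "d (Suc (q * L))"
  have "?e [^] m \<notin> S" if m: "0 < m" "m \<le> q" for m
  proof
    assume s: "?e [^] m \<in> S"
    then have "ord (?e [^] m) dvd L" unfolding L_def using S(1) by (simp add: dvd_prod_eqI)
    then have "(?e [^] m) [^] L = \<one>" using d by (simp add: pow_eq_id)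
    then have "?e [^] (m * L) = \<one>" using d by (simp add: nat_pow_pow)
    then have "ord ?e dvd m * L" using d by (simp add: pow_eq_id)
    then have "ord ?e \<le> m * L" using m L by (simp add: dvd_imp_le)
    also have "\<dots> \<le> q * L" using m by simp
    finally show False using d(2)[of "Suc (q * L)"] by simp
  qed
  then show "\<exists>e\<in>range d. \<forall>m::nat. 0 < m \<longrightarrow> m \<le> q \<longrightarrow> e [^] m \<notin> S" by blast
qed

lemma countable_power_avoiding:
  assumes "group_exp G = \<infinity>"
  shows "\<exists>C. countable C \<and> power_avoiding C"
proof (cases "\<exists>g\<in>carrier G. ord g = 0")
  case True
  then obtain g where "g \<in> carrier G" "ord g = 0" by blast
  then have "power_avoiding (range (\<lambda>k::nat. g [^] k))" by (rule power_avoiding_infinite_order)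
  then show ?thesis by (intro exI[of _ "range (\<lambda>k::nat. g [^] k)"]) simp
next
  case False
  have "Lcm (ord ` carrier G) = 0"
    using assms unfolding group_exp_def Let_def by (auto split: if_splits)
  then have "infinite (ord ` carrier G)" using False Lcm_0_iff_nat by (metis imageE)
  then have "\<forall>n. \<exists>x. x \<in> carrier G \<and> ord x \<ge> n"
    unfolding infinite_nat_iff_unbounded_le by blast
  then obtain d where d: "\<And>n. d n \<in> carrier G" "\<And>n. ord (d n) \<ge> n" by metis
  have "power_avoiding (range d)"
    using False d by (intro power_avoiding_unbounded_orders) auto
  then show ?thesis by (intro exI[of _ "range d"]) simp
qed

text \<open>For a constant sequence of sets, the basic neighbourhood is the subgroup that the set generates.\<close>

lemma countable_subgroup_superset:
  assumes "countable B" "B \<subseteq> carrier G"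
  shows "\<exists>Y. subgroup Y G \<and> countable Y \<and> B \<subseteq> Y"
proof -
  define E where "E = insert \<one> (B \<union> (\<lambda>x. inv x) ` B)"
  have E: "E \<subseteq> carrier G" "\<one> \<in> E" "\<And>x. x \<in> E \<Longrightarrow> inv x \<in> E" "countable E"
    using assms by (auto simp: E_def)
  interpret shrinking_sets G "\<lambda>_. E"
    by unfold_locales (use E in auto)
  let ?Y = "nbhd (\<lambda>_. 0)"
  have "subgroup ?Y G"
  proof (rule subgroupI)
    show "?Y \<subseteq> carrier G" by (rule nbhd_closed)
    show "?Y \<noteq> {}" using one_in_nbhd by blast
    show "inv a \<in> ?Y" if "a \<in> ?Y" for a using that by (rule nbhd_inv)
    fix a b assume "a \<in> ?Y" "b \<in> ?Y"
    then obtain n m where "a \<in> prefix_product (\<lambda>_. E) n" "b \<in> prefix_product (\<lambda>_. E) m"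
      unfolding nbhd_def by blast
    then have "a \<otimes> b \<in> prefix_product (\<lambda>_. E) (n + m)"
      using prefix_product_append[of "\<lambda>_. E" n m] E(1) unfolding set_mult_def by blast
    then show "a \<otimes> b \<in> ?Y" unfolding nbhd_def by blast
  qed
  moreover have "countable (prefix_product (\<lambda>_. E) n)" for n
    by (induction n) (use E(4) in \<open>auto simp: set_mult_def\<close>)
  then have "countable ?Y" unfolding nbhd_def by blast
  moreover have "B \<subseteq> ?Y" using A_subset_nbhd[of "\<lambda>_. 0"] unfolding E_def by blast
  ultimately show ?thesis by blast
qed

lemma power_avoiding_int:
  assumes Y: "power_avoiding Y" and S: "finite S" "S \<subseteq> carrier G"
  shows "\<exists>e\<in>Y. \<forall>m::int. m \<noteq> 0 \<longrightarrow> \<bar>m\<bar> \<le> int q \<longrightarrow> e [^] m \<notin> S"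
proof -
  let ?S = "S \<union> (\<lambda>x. inv x) ` S"
  have "finite ?S" "?S \<subseteq> carrier G" using S by auto
  then obtain e where e: "e \<in> Y" "\<And>m::nat. 0 < m \<Longrightarrow> m \<le> q \<Longrightarrow> e [^] m \<notin> ?S"
    using Y unfolding power_avoiding_def by meson
  have eG: "e \<in> carrier G" using e(1) Y unfolding power_avoiding_def by blast
  have "e [^] m \<notin> S" if m: "m \<noteq> 0" "\<bar>m\<bar> \<le> int q" for m :: int
  proof (cases m rule: int_cases2)
    case (nonneg n)
    then show ?thesis using e(2)[of n] m by (auto simp: int_pow_int)
  next
    case (nonpos n)
    show ?thesis
    proof
      assume "e [^] m \<in> S"
      then have "inv (e [^] m) \<in> ?S" by blast
      then have "e [^] n \<in> ?S" using nonpos eG by (simp add: int_pow_neg_int)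
      then show False using e(2)[of n] m nonpos by auto
    qed
  qed
  then show ?thesis using e(1) by blast
qed

text \<open>A new element \<open>e\<close> is needed with \<open>(e \<otimes> inv b) [^] m \<notin> S\<close> for all earlier \<open>b\<close>, that is, with
  \<open>e [^] m\<close> outside the finite set of the \<open>s \<otimes> b [^] m\<close>. The earlier elements are also put into
  the set to be avoided, so that \<open>e\<close> is new.\<close>

lemma pairwise_power_avoiding:
  assumes Y: "power_avoiding Y" and S: "finite S" "S \<subseteq> carrier G"
  shows "\<exists>D. finite D \<and> card D = n \<and> D \<subseteq> Y \<and>
    (\<forall>a\<in>D. \<forall>b\<in>D. a \<noteq> b \<longrightarrow> (\<forall>m::int. m \<noteq> 0 \<longrightarrow> \<bar>m\<bar> \<le> int q \<longrightarrow> (a \<otimes> inv b) [^] m \<notin> S))"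
proof (induction n)
  case 0
  show ?case by (intro exI[of _ "{}"]) simp
next
  case (Suc n)
  then obtain D where D: "finite D" "card D = n" "D \<subseteq> Y"
    "\<And>a b m. a \<in> D \<Longrightarrow> b \<in> D \<Longrightarrow> a \<noteq> b \<Longrightarrow> m \<noteq> 0 \<Longrightarrow> \<bar>m\<bar> \<le> int q \<Longrightarrow> (a \<otimes> inv b) [^] (m::int) \<notin> S"
    by metis
  have YG: "Y \<subseteq> carrier G" using Y unfolding power_avoiding_def by blast
  define T where "T = D \<union> (\<lambda>(s, b, m). s \<otimes> b [^] (m::int)) ` (S \<times> D \<times> {- int q..int q})"
  have "finite T" using D S by (auto simp: T_def)
  moreover have "D \<subseteq> carrier G" using D(3) YG by blast
  then have "T \<subseteq> carrier G" using S(2) unfolding T_def by auto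
  ultimately obtain e where e: "e \<in> Y" "\<And>m::int. m \<noteq> 0 \<Longrightarrow> \<bar>m\<bar> \<le> int (Suc q) \<Longrightarrow> e [^] m \<notin> T"
    using power_avoiding_int[OF Y] by meson
  have eG: "e \<in> carrier G" using e YG by blast
  have eD: "e \<notin> D" using e(2)[of 1] eG by (auto simp: T_def)
  have new: "(e \<otimes> inv b) [^] m \<notin> S" if b: "b \<in> D" and m: "m \<noteq> 0" "\<bar>m\<bar> \<le> int q" for b and m :: int
  proof
    assume s: "(e \<otimes> inv b) [^] m \<in> S"
    have bG: "b \<in> carrier G" using b D YG by blast
    have "(e \<otimes> inv b) [^] m \<otimes> b [^] m = ((e \<otimes> inv b) \<otimes> b) [^] m"
      using eG bG by (simp add: int_pow_distrib)
    also have "\<dots> = e [^] m" using eG bG by (simp add: m_assoc)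
    finally have "e [^] m = (e \<otimes> inv b) [^] m \<otimes> b [^] m" ..
    moreover have "(e \<otimes> inv b) [^] m \<otimes> b [^] m \<in> T"
      unfolding T_def using s b m by (force simp: image_iff)
    ultimately show False using e(2)[of m] m by simp
  qed
  have new': "(b \<otimes> inv e) [^] m \<notin> S" if b: "b \<in> D" and m: "m \<noteq> 0" "\<bar>m\<bar> \<le> int q" for b and m :: int
  proof -
    have bG: "b \<in> carrier G" using b D YG by blast
    have "b \<otimes> inv e = inv (e \<otimes> inv b)" using eG bG by (simp add: inv_mult m_comm)
    then have "(b \<otimes> inv e) [^] m = (e \<otimes> inv b) [^] (- m)"
      using eG bG by (simp add: int_pow_neg int_pow_inv)
    then show ?thesis using new[OF b, of "- m"] m by simp
  qed
  have "card (insert e D) = Suc n" using D eD by simp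
  moreover have "\<forall>a\<in>insert e D. \<forall>b\<in>insert e D. a \<noteq> b \<longrightarrow>
      (\<forall>m::int. m \<noteq> 0 \<longrightarrow> \<bar>m\<bar> \<le> int q \<longrightarrow> (a \<otimes> inv b) [^] m \<notin> S)"
    using D(4) new new' by (metis insertE)
  ultimately show ?case using D e(1) by (intro exI[of _ "insert e D"]) simp
qed

text \<open>Cut the circle into finitely many cells of diameter less than \<open>\<delta>\<close> and colour an element by the cells
  of its values under the characters in \<open>\<Psi>\<close>. More elements than colours, pairwise as in the
  preceding lemma, contain two of the same colour; their quotient is the required element.\<close>

lemma power_avoiding_near_kernel:
  assumes Y: "power_avoiding Y" "subgroup Y G" and S: "finite S" "S \<subseteq> carrier G"
    and \<Psi>: "finite \<Psi>" "\<Psi> \<subseteq> hom G circle_group" and \<delta>: "\<delta> > 0"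
  shows "\<exists>e\<in>Y. (\<forall>m::int. m \<noteq> 0 \<longrightarrow> \<bar>m\<bar> \<le> int q \<longrightarrow> e [^] m \<notin> S) \<and>
    (\<forall>\<psi>\<in>\<Psi>. norm (\<psi> e - 1) < \<delta>)"
proof -
  have "compact (sphere (0::complex) 1)" by simp
  then obtain K where K: "finite K" "sphere (0::complex) 1 \<subseteq> (\<Union>k\<in>K. ball k (\<delta> / 2))"
    using \<delta> unfolding compact_eq_totally_bounded by (meson half_gt_zero)
  define cell where "cell z = (SOME k. k \<in> K \<and> z \<in> ball k (\<delta> / 2))" for z
  have cell: "cell z \<in> K" "z \<in> ball (cell z) (\<delta> / 2)" if "norm z = 1" for z
  proof -
    have "\<exists>k. k \<in> K \<and> z \<in> ball k (\<delta> / 2)" using K(2) that by force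
    from someI_ex[OF this] show "cell z \<in> K" "z \<in> ball (cell z) (\<delta> / 2)" unfolding cell_def by auto
  qed
  define col where "col a = restrict (\<lambda>\<psi>. cell (\<psi> a)) \<Psi>" for a
  let ?P = "PiE \<Psi> (\<lambda>_. K)"
  have finP: "finite ?P" using K(1) \<Psi>(1) by (simp add: finite_PiE)
  obtain D where D: "finite D" "card D = Suc (card ?P)" "D \<subseteq> Y"
    "\<And>a b m. a \<in> D \<Longrightarrow> b \<in> D \<Longrightarrow> a \<noteq> b \<Longrightarrow> m \<noteq> 0 \<Longrightarrow> \<bar>m\<bar> \<le> int q \<Longrightarrow> (a \<otimes> inv b) [^] (m::int) \<notin> S"
    using pairwise_power_avoiding[OF Y(1) S, of "Suc (card ?P)" q] by metis
  have YG: "Y \<subseteq> carrier G" using Y(1) unfolding power_avoiding_def by blast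
  have n1: "norm (\<psi> a) = 1" if "\<psi> \<in> \<Psi>" "a \<in> Y" for \<psi> a
    using that \<Psi>(2) YG character_norm by blast
  have "col ` D \<subseteq> ?P"
  proof
    fix c assume "c \<in> col ` D"
    then obtain a where a: "a \<in> D" "c = col a" by blast
    then show "c \<in> ?P" using n1 cell(1) D(3) by (auto simp: col_def)
  qed
  then have "\<not> inj_on col D" using D(2) finP card_inj_on_le[of col D ?P] by auto
  then obtain a b where ab: "a \<in> D" "b \<in> D" "a \<noteq> b" "col a = col b" unfolding inj_on_def by blast
  have abY: "a \<in> Y" "b \<in> Y" and abG: "a \<in> carrier G" "b \<in> carrier G" using ab D YG by auto
  have "norm (\<psi> (a \<otimes> inv b) - 1) < \<delta>" if \<psi>: "\<psi> \<in> \<Psi>" for \<psi>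
  proof -
    have hom: "\<psi> \<in> hom G circle_group" using \<psi> \<Psi> by blast
    have "cell (\<psi> a) = cell (\<psi> b)" using ab(4) \<psi> unfolding col_def by (metis restrict_apply')
    moreover have "dist (cell (\<psi> a)) (\<psi> a) < \<delta> / 2" "dist (cell (\<psi> b)) (\<psi> b) < \<delta> / 2"
      using cell(2)[OF n1[OF \<psi> abY(1)]] cell(2)[OF n1[OF \<psi> abY(2)]] by auto
    ultimately have "dist (\<psi> a) (\<psi> b) < \<delta>" by (metis dist_triangle_half_r)
    moreover have "\<psi> b \<noteq> 0" using n1[OF \<psi> abY(2)] by auto
    then have "\<psi> (a \<otimes> inv b) - 1 = (\<psi> a - \<psi> b) / \<psi> b"
      using hom abG by (simp add: character_mult character_inv field_simps)
    ultimately show ?thesis using n1[OF \<psi> abY(2)] by (simp add: norm_divide dist_norm)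
  qed
  moreover have "a \<otimes> inv b \<in> Y" using abY Y(2) by (simp add: subgroup.m_closed subgroup.m_inv_closed)
  ultimately show ?thesis using D(4)[OF ab(1-3)] by blast
qed

lemma finprod_lessThan_Suc:
  "(\<And>i. i < Suc n \<Longrightarrow> f i \<in> carrier G) \<Longrightarrow> finprod G f {..<Suc n} = finprod G f {..<n} \<otimes> f n"
  by (simp add: lessThan_Suc Pi_def m_comm)

lemma finprod_int_pow:
  fixes n :: nat
  assumes "\<And>i. i < n \<Longrightarrow> f i \<in> carrier G"
  shows "finprod G f {..<n} [^] (b::int) = finprod G (\<lambda>i. f i [^] b) {..<n}"
  using assms
proof (induction n)
  case (Suc n)
  have "finprod G f {..<n} \<in> carrier G" using Suc.prems by (auto intro!: finprod_closed)
  then show ?case using Suc by (simp add: finprod_lessThan_Suc int_pow_distrib)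
qed simp

text \<open>The elements are chosen one after the other. Small powers of the last one avoid the quotients of
  elements of \<open>S\<close> by the earlier products with small exponents, so its exponent must vanish if the
  whole product is to lie in \<open>S\<close>.\<close>

lemma dissociated_near_kernel:
  assumes Y: "power_avoiding Y" "subgroup Y G" and S: "finite S" "S \<subseteq> carrier G"
    and \<Psi>: "finite \<Psi>" "\<Psi> \<subseteq> hom G circle_group" and \<delta>: "\<delta> > 0"
  shows "\<exists>e::nat \<Rightarrow> 'a. (\<forall>j. e j \<in> Y) \<and> (\<forall>j<n. \<forall>\<psi>\<in>\<Psi>. norm (\<psi> (e j) - 1) < \<delta>) \<and>
    (\<forall>c::nat \<Rightarrow> int. (\<forall>j<n. \<bar>c j\<bar> \<le> int q) \<longrightarrow> finprod G (\<lambda>j. e j [^] c j) {..<n} \<in> S \<longrightarrow>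
      (\<forall>j<n. c j = 0))"
proof (induction n)
  case 0
  show ?case using subgroup.one_closed[OF Y(2)] by (intro exI[of _ "\<lambda>_. \<one>"]) simp
next
  case (Suc n)
  then obtain e where e: "\<And>j. e j \<in> Y" "\<And>j \<psi>. j < n \<Longrightarrow> \<psi> \<in> \<Psi> \<Longrightarrow> norm (\<psi> (e j) - 1) < \<delta>"
    "\<And>c j. (\<forall>j<n. \<bar>c j\<bar> \<le> int q) \<Longrightarrow> finprod G (\<lambda>j. e j [^] c j) {..<n} \<in> S \<Longrightarrow> j < n \<Longrightarrow> c j = 0"
    by metis
  have YG: "Y \<subseteq> carrier G" using Y(1) unfolding power_avoiding_def by blast
  have eG: "e j \<in> carrier G" for j using e(1) YG by blast
  have fc: "finprod G (\<lambda>j. e j [^] c j) {..<n} \<in> carrier G" for c :: "nat \<Rightarrow> int"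
    using eG by (auto intro!: finprod_closed)
  define T where "T = (\<lambda>(s, c). s \<otimes> inv (finprod G (\<lambda>j. e j [^] (c j :: int)) {..<n})) `
    (S \<times> PiE {..<n} (\<lambda>_. {- int q..int q}))"
  have "finite T" unfolding T_def using S(1) by (auto intro!: finite_PiE)
  moreover have "T \<subseteq> carrier G" unfolding T_def using S(2) fc by auto
  ultimately obtain y where y: "y \<in> Y" "\<And>m::int. m \<noteq> 0 \<Longrightarrow> \<bar>m\<bar> \<le> int q \<Longrightarrow> y [^] m \<notin> T"
    "\<And>\<psi>. \<psi> \<in> \<Psi> \<Longrightarrow> norm (\<psi> y - 1) < \<delta>"
    using power_avoiding_near_kernel[OF Y _ _ \<Psi> \<delta>, of T q] by metis
  have yG: "y \<in> carrier G" using y(1) YG by blast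
  let ?e = "e(n := y)"
  have dis: "\<forall>j<Suc n. c j = 0"
    if c: "\<forall>j<Suc n. \<bar>c j\<bar> \<le> int q" and s: "finprod G (\<lambda>j. ?e j [^] c j) {..<Suc n} \<in> S" for c :: "nat \<Rightarrow> int"
  proof -
    let ?f = "finprod G (\<lambda>j. e j [^] c j) {..<n}"
    have "finprod G (\<lambda>j. ?e j [^] c j) {..<n} = ?f"
      by (rule finprod_cong') (use eG in auto)
    then have eq: "finprod G (\<lambda>j. ?e j [^] c j) {..<Suc n} = ?f \<otimes> y [^] c n"
      using eG yG by (subst finprod_lessThan_Suc) auto
    have f_eq: "?f = finprod G (\<lambda>j. e j [^] restrict c {..<n} j) {..<n}"
      by (rule finprod_cong') (use eG in auto)
    moreover have "c j \<in> {- int q..int q}" if "j < n" for j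
      using c[rule_format, of j] that by (simp add: abs_le_iff minus_le_iff)
    then have "restrict c {..<n} \<in> PiE {..<n} (\<lambda>_. {- int q..int q})"
      by auto
    moreover have "y [^] c n = (?f \<otimes> y [^] c n) \<otimes> inv ?f"
      using fc[of c] yG by (simp add: m_ac inv_solve_right)
    then have "y [^] c n = (?f \<otimes> y [^] c n) \<otimes> inv (finprod G (\<lambda>j. e j [^] restrict c {..<n} j) {..<n})"
      by (simp only: f_eq)
    moreover have "?f \<otimes> y [^] c n \<in> S" using s eq by simp
    ultimately have "y [^] c n \<in> T"
      unfolding T_def by (intro image_eqI[of _ _ "(?f \<otimes> y [^] c n, restrict c {..<n})"]) auto
    then have cn: "c n = 0" using y(2)[of "c n"] c by auto
    then have "?f \<in> S" using s eq fc[of c] yG by simp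
    moreover have "\<forall>j<n. \<bar>c j\<bar> \<le> int q" using c by simp
    ultimately have "c j = 0" if "j < n" for j using e(3)[of c j] that by blast
    then show ?thesis using cn less_Suc_eq by metis
  qed
  have "\<forall>j<Suc n. \<forall>\<psi>\<in>\<Psi>. norm (\<psi> (?e j) - 1) < \<delta>" using e(2) y(3) by (auto simp: less_Suc_eq)
  then show ?case using e(1) y(1) dis by (intro exI[of _ ?e]) auto
qed

end

section \<open>Finite sets that force characters to be small at a given element\<close>

text \<open>In \<open>z ^ M - 1 = (z - 1) * (1 + z + \<dots> + z ^ (M - 1))\<close> all terms of the second factor have real part
  at least \<open>1 / 2\<close>. So small powers stay near \<open>1\<close> only if \<open>z\<close> is nearer by a factor of order \<open>M\<close>.\<close>

lemma root_distance_bound: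
  fixes z :: complex
  assumes "\<And>m. m < M \<Longrightarrow> norm (z ^ m - 1) \<le> 1 / 2"
  shows "real M * norm (z - 1) \<le> 2 * norm (z ^ M - 1)"
proof -
  have "Re (z ^ m) \<ge> 1 / 2" if "m < M" for m
    using abs_Re_le_cmod[of "z ^ m - 1"] assms[OF that] by simp
  then have "(\<Sum>m<M. 1 / 2) \<le> (\<Sum>m<M. Re (z ^ m))" by (intro sum_mono) simp
  then have "real M / 2 \<le> Re (\<Sum>m<M. z ^ m)" by simp
  also have "\<dots> \<le> norm (\<Sum>m<M. z ^ m)" by (rule complex_Re_le_cmod)
  finally have "norm (z - 1) * (real M / 2) \<le> norm (z - 1) * norm (\<Sum>m<M. z ^ m)"
    by (intro mult_left_mono) auto
  also have "\<dots> = norm (z ^ M - 1)" by (simp add: power_diff_1_eq norm_mult)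
  finally show ?thesis by (simp add: mult.commute)
qed

context comm_group
begin

definition block :: "nat \<Rightarrow> (nat \<Rightarrow> 'a) \<Rightarrow> 'a \<Rightarrow> 'a set" where
  "block n e u = insert \<one> ({e j [^] m | j m. j < n \<and> \<bar>m::int\<bar> \<le> int n} \<union> {u, inv u})"

lemma block_finite: "finite (block n e u)"
proof -
  have "{e j [^] m | j m. j < n \<and> \<bar>m::int\<bar> \<le> int n}
      \<subseteq> (\<lambda>(j, m). e j [^] m) ` ({..<n} \<times> {- int n..int n})" by force
  then have "finite {e j [^] m | j m. j < n \<and> \<bar>m::int\<bar> \<le> int n}"
    by (rule finite_subset) simp
  then show ?thesis unfolding block_def by simp
qed

lemma block_subset_subgroup:
  assumes Y: "subgroup Y G" and "\<And>j. j < n \<Longrightarrow> e j \<in> Y" "u \<in> Y"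
  shows "block n e u \<subseteq> Y"
  using assms subgroup_int_pow_closed[OF Y] subgroup.one_closed[OF Y] subgroup.m_inv_closed[OF Y]
  by (auto simp: block_def)

lemma block_inv:
  assumes "\<And>j. j < n \<Longrightarrow> e j \<in> carrier G" "u \<in> carrier G" "x \<in> block n e u"
  shows "inv x \<in> block n e u"
proof -
  consider "x = \<one>" | "x = u" | "x = inv u" | j m where "j < n" "\<bar>m::int\<bar> \<le> int n" "x = e j [^] m"
    using assms(3) unfolding block_def by blast
  then show ?thesis
  proof cases
    case 4
    then have "inv x = e j [^] (- m)" using assms(1) by (simp add: int_pow_neg)
    moreover have "\<bar>- m\<bar> \<le> int n" using 4 by simp
    ultimately show ?thesis using 4(1) unfolding block_def by blast
  qed (use assms(2) in \<open>auto simp: block_def\<close>)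
qed

text \<open>What matters about a product of \<open>N\<close> elements of a block, besides the size of the exponents, is that
  at most \<open>N\<close> of the \<open>e j\<close> occur on their own, outside the factor \<open>u [^] b\<close>.\<close>

lemma block_products:
  assumes e: "\<And>j. e j \<in> carrier G" and u: "u \<in> carrier G"
    and x: "x \<in> prefix_product (\<lambda>_. block n e u) N"
  shows "\<exists>(c :: nat \<Rightarrow> int) b. x = finprod G (\<lambda>j. e j [^] c j) {..<n} \<otimes> u [^] b \<and>
    \<bar>b\<bar> \<le> int N \<and> (\<forall>j. \<bar>c j\<bar> \<le> int (N * n)) \<and> card {j. j < n \<and> c j \<noteq> 0} \<le> N"
  using x
proof (induction N arbitrary: x)
  case 0
  then have "x = finprod G (\<lambda>j. e j [^] (0::int)) {..<n} \<otimes> u [^] (0::int)" by simp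
  then show ?case by (intro exI[of _ "\<lambda>_. 0"] exI[of _ 0]) simp
next
  case (Suc N)
  then obtain a y where a: "a \<in> prefix_product (\<lambda>_. block n e u) N" and y: "y \<in> block n e u"
    and xay: "x = a \<otimes> y" by (auto simp: mem_set_mult)
  obtain c b where cb: "a = finprod G (\<lambda>j. e j [^] c j) {..<n} \<otimes> u [^] b"
    "\<bar>b\<bar> \<le> int N" "\<forall>j. \<bar>c j\<bar> \<le> int (N * n)" "card {j. j < n \<and> c j \<noteq> 0} \<le> N"
    using Suc.IH[OF a] by blast
  let ?p = "\<lambda>c. finprod G (\<lambda>j. e j [^] (c j :: int)) {..<n}"
  have pG: "?p c \<in> carrier G" for c using e by (auto intro!: finprod_closed)
  have c': "\<forall>j. \<bar>c j\<bar> \<le> int (Suc N * n)" using cb(3) by (auto intro: order_trans)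
  have u_case: ?case if t: "y = u [^] t" "\<bar>t\<bar> \<le> 1" for t :: int
  proof -
    have "x = ?p c \<otimes> u [^] (b + t)"
      using xay cb(1) t(1) pG u by (simp add: m_assoc int_pow_mult)
    moreover have "\<bar>b + t\<bar> \<le> int (Suc N)" using cb(2) t(2) by simp
    ultimately show ?case using c' cb(4) by (intro exI[of _ c] exI[of _ "b + t"]) auto
  qed
  consider "y = u [^] (0::int)" | "y = u [^] (1::int)" | "y = u [^] (-1::int)"
    | i m where "i < n" "\<bar>m::int\<bar> \<le> int n" "y = e i [^] m"
    using y u unfolding block_def by (auto simp: int_pow_neg)
  then show ?case
  proof cases
    case 4
    define d where "d = c(i := c i + m)"
    have "?p d = finprod G (\<lambda>j. e j [^] c j \<otimes> (if i = j then e j [^] m else \<one>)) {..<n}"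
      by (rule finprod_cong') (use e in \<open>auto simp: d_def int_pow_mult\<close>)
    also have "\<dots> = ?p c \<otimes> finprod G (\<lambda>j. if i = j then e j [^] m else \<one>) {..<n}"
      using e by (intro finprod_multf) auto
    also have "\<dots> = ?p c \<otimes> y"
      using finprod_singleton[of i "{..<n}" "\<lambda>j. e j [^] m"] e 4 by auto
    finally have "?p d = ?p c \<otimes> y" .
    moreover have "y \<in> carrier G" using 4(3) e by simp
    ultimately have "x = ?p d \<otimes> u [^] b"
      using xay cb(1) pG[of c] u by (simp add: m_ac)
    moreover have "\<bar>d j\<bar> \<le> int (Suc N * n)" for j
    proof -
      have "\<bar>d j\<bar> \<le> \<bar>c j\<bar> + int n" using 4(2) by (auto simp: d_def)
      also have "\<dots> \<le> int (N * n) + int n" using cb(3) by simp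
      finally show ?thesis by simp
    qed
    moreover have "card {j. j < n \<and> d j \<noteq> 0} \<le> Suc N"
    proof -
      have "card {j. j < n \<and> d j \<noteq> 0} \<le> card (insert i {j. j < n \<and> c j \<noteq> 0})"
        by (rule card_mono) (auto simp: d_def)
      also have "\<dots> \<le> Suc (card {j. j < n \<and> c j \<noteq> 0})" by (rule card_insert_le_m1) simp_all
      finally show ?thesis using cb(4) by simp
    qed
    ultimately show ?thesis using cb(2) by (intro exI[of _ d] exI[of _ b]) auto
  qed (use u_case[of 0] u_case[of 1] u_case[of "-1"] in auto)
qed

text \<open>The block contains the powers of the \<open>e j\<close> up to exponent \<open>n\<close>, so each \<open>\<phi> (e j)\<close> is \<open>n\<close> times closer
  to \<open>1\<close> than the elements of the block are required to be. This compensates for the \<open>n\<close> factors of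
  the product of the \<open>e j\<close>, which can therefore be cancelled from \<open>h \<otimes> finprod G e {..<n}\<close>.\<close>

lemma block_forces_small:
  assumes \<phi>: "\<phi> \<in> hom G circle_group" and e: "\<And>j. e j \<in> carrier G" and h: "h \<in> carrier G"
    and n: "n > 0" and \<epsilon>: "\<epsilon> \<le> 1 / 2"
    and small: "\<And>x. x \<in> block n e (h \<otimes> finprod G e {..<n}) \<Longrightarrow> norm (\<phi> x - 1) \<le> \<epsilon>"
  shows "norm (\<phi> h - 1) \<le> 3 * \<epsilon>"
proof -
  let ?p = "finprod G e {..<n}"
  have pG: "?p \<in> carrier G" using e by (auto intro!: finprod_closed)
  have ej: "norm (\<phi> (e j) - 1) \<le> 2 * \<epsilon> / n" if j: "j < n" for j
  proof -
    have pw: "norm (\<phi> (e j) ^ m - 1) \<le> \<epsilon>" if "m \<le> n" for m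
    proof -
      have "e j [^] int m \<in> block n e (h \<otimes> ?p)" using j that unfolding block_def by force
      from small[OF this] show ?thesis using \<phi> e by (simp add: int_pow_int character_pow)
    qed
    have "real n * norm (\<phi> (e j) - 1) \<le> 2 * norm (\<phi> (e j) ^ n - 1)"
      by (rule root_distance_bound) (use pw \<epsilon> in \<open>meson less_imp_le order_trans\<close>)
    also have "\<dots> \<le> 2 * \<epsilon>" using pw[of n] by simp
    finally show ?thesis using n by (simp add: field_simps)
  qed
  have "norm (\<phi> ?p - 1) \<le> (\<Sum>j<n. norm (\<phi> (e j) - 1))"
    by (rule character_dist_finprod[OF \<phi>]) (rule e)
  also have "\<dots> \<le> (\<Sum>j<n. 2 * \<epsilon> / n)" by (intro sum_mono ej) simp
  also have "\<dots> = 2 * \<epsilon>" using n by simp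
  finally have p: "norm (\<phi> (inv ?p) - 1) \<le> 2 * \<epsilon>" using character_dist_inv[OF \<phi> pG] by simp
  have "h = (h \<otimes> ?p) \<otimes> inv ?p" using h pG by (simp add: m_assoc)
  then have "norm (\<phi> h - 1) \<le> norm (\<phi> (h \<otimes> ?p) - 1) + norm (\<phi> (inv ?p) - 1)"
    using character_dist_mult[OF \<phi>, of "h \<otimes> ?p" "inv ?p"] h pG by simp
  moreover have "h \<otimes> ?p \<in> block n e (h \<otimes> ?p)" by (simp add: block_def)
  ultimately show ?thesis using p small by fastforce
qed

lemma block_near_kernel:
  assumes \<psi>: "\<psi> \<in> hom G circle_group" and e: "\<And>j. e j \<in> carrier G" and h: "h \<in> carrier G" "\<psi> h = 1"
    and small: "\<And>j. j < n \<Longrightarrow> norm (\<psi> (e j) - 1) < \<delta> / Suc n" and \<delta>: "\<delta> > 0"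
    and x: "x \<in> block n e (h \<otimes> finprod G e {..<n})"
  shows "norm (\<psi> x - 1) < \<delta>"
proof -
  let ?p = "finprod G e {..<n}"
  have pG: "?p \<in> carrier G" using e by (auto intro!: finprod_closed)
  have less: "real n * (\<delta> / Suc n) < \<delta>" using \<delta> by (simp add: field_simps)
  have "norm (\<psi> ?p - 1) \<le> (\<Sum>j<n. norm (\<psi> (e j) - 1))"
    by (rule character_dist_finprod[OF \<psi>]) (rule e)
  also have "\<dots> \<le> (\<Sum>j<n. \<delta> / Suc n)" by (intro sum_mono less_imp_le small) simp
  finally have p: "norm (\<psi> ?p - 1) < \<delta>" using less by simp
  have hp: "\<psi> (h \<otimes> ?p) = \<psi> ?p" using character_mult[OF \<psi> h(1) pG] h(2) by simp
  consider "x = \<one>" | "x = h \<otimes> ?p" | "x = inv (h \<otimes> ?p)" | j m where "j < n" "\<bar>m::int\<bar> \<le> int n" "x = e j [^] m"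
    using x unfolding block_def by blast
  then show ?thesis
  proof cases
    case 3
    then show ?thesis using p hp character_dist_inv[OF \<psi>, of "h \<otimes> ?p"] h pG by simp
  next
    case 4
    have "norm (\<psi> (e j [^] m) - 1) \<le> norm (\<psi> (e j [^] nat \<bar>m\<bar>) - 1)"
    proof (cases m rule: int_cases2)
      case (nonneg k)
      then show ?thesis by (simp add: int_pow_int)
    next
      case (nonpos k)
      then show ?thesis using character_dist_inv[OF \<psi>, of "e j [^] k"] e by (simp add: int_pow_neg_int)
    qed
    also have "\<dots> \<le> real (nat \<bar>m\<bar>) * norm (\<psi> (e j) - 1)" by (rule character_dist_pow[OF \<psi> e])
    also have "\<dots> \<le> real n * (\<delta> / Suc n)"
      using 4 less_imp_le[OF small[OF 4(1)]] by (intro mult_mono) auto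
    finally show ?thesis using less 4(3) by simp
  qed (use p hp \<psi> \<delta> in auto)
qed

text \<open>By dissociation, a product of \<open>N\<close> elements of the block that lies in \<open>F\<close> has total exponent
  \<open>c j + b = 0\<close> at each of the \<open>n\<close> elements \<open>e j\<close>, where \<open>b\<close> is the exponent of
  \<open>h \<otimes> finprod G e {..<n}\<close>. As \<open>N < n\<close>, some \<open>c j\<close> is \<open>0\<close>. Hence \<open>b = 0\<close>, and then all \<open>c j\<close>
  are \<open>0\<close>.\<close>

lemma block_products_avoid:
  assumes e: "\<And>j. e j \<in> carrier G" and h: "h \<in> carrier G" and F: "F \<subseteq> carrier G" and Nn: "N < n"
    and dis: "\<And>c j. (\<forall>j<n. \<bar>c j\<bar> \<le> int (N * n + N)) \<Longrightarrow>
      finprod G (\<lambda>j. e j [^] (c j :: int)) {..<n} \<in> (\<lambda>(s, b). s \<otimes> h [^] b) ` (F \<times> {- int N..int N}) \<Longrightarrow>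
      j < n \<Longrightarrow> c j = 0"
    and x: "x \<in> prefix_product (\<lambda>_. block n e (h \<otimes> finprod G e {..<n})) N" "x \<in> F"
  shows "x = \<one>"
proof -
  let ?p = "\<lambda>c. finprod G (\<lambda>j. e j [^] (c j :: int)) {..<n}"
  let ?q = "finprod G e {..<n}"
  have pG: "?p c \<in> carrier G" for c using e by (auto intro!: finprod_closed)
  have qG: "?q \<in> carrier G" using e by (auto intro!: finprod_closed)
  obtain c b where cb: "x = ?p c \<otimes> (h \<otimes> ?q) [^] b" "\<bar>b\<bar> \<le> int N" "\<And>j. \<bar>c j\<bar> \<le> int (N * n)"
    "card {j. j < n \<and> c j \<noteq> 0} \<le> N"
    using block_products[OF e _ x(1)] h qG by blast
  have "(h \<otimes> ?q) [^] b = h [^] b \<otimes> ?p (\<lambda>_. b)"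
    using h qG e by (simp add: int_pow_distrib finprod_int_pow)
  moreover have "?p (\<lambda>j. c j + b) = ?p c \<otimes> ?p (\<lambda>_. b)"
    using e by (simp add: int_pow_mult Pi_def)
  ultimately have xeq: "x = ?p (\<lambda>j. c j + b) \<otimes> h [^] b"
    using cb(1) pG h by (simp add: m_ac)
  have "?p (\<lambda>j. c j + b) = x \<otimes> h [^] (- b)"
    using xeq pG h by (simp add: int_pow_neg m_assoc)
  then have "?p (\<lambda>j. c j + b) \<in> (\<lambda>(s, b). s \<otimes> h [^] b) ` (F \<times> {- int N..int N})"
    using x(2) cb(2) by (intro image_eqI[of _ _ "(x, - b)"]) auto
  moreover have "\<bar>c j + b\<bar> \<le> int (N * n + N)" for j using cb(2) cb(3)[of j] by simp
  ultimately have z: "c j + b = 0" if "j < n" for j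
    using dis[of "\<lambda>j. c j + b", OF _ _ that] by blast
  have "\<exists>j<n. c j = 0"
  proof (rule ccontr)
    assume "\<not> ?thesis"
    then have "{j. j < n \<and> c j \<noteq> 0} = {..<n}" by auto
    then show False using cb(4) Nn by simp
  qed
  then have b0: "b = 0" using z by force
  have "?p (\<lambda>j. c j + b) = finprod G (\<lambda>j. \<one>) {..<n}"
    by (rule finprod_cong') (use z in auto)
  then show "x = \<one>" using xeq b0 h by simp
qed

text \<open>One stage of the construction, with the two opposite demands on \<open>w\<close>: it is so sparse that products of
  \<open>N\<close> of its elements avoid \<open>F\<close>, and yet a character that is small on \<open>w\<close> has to be small at \<open>h\<close>.\<close>

lemma forcing_set:
  assumes Y: "power_avoiding Y" "subgroup Y G" and h: "h \<in> Y" and F: "finite F" "F \<subseteq> carrier G"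
    and \<Psi>: "finite \<Psi>" "\<Psi> \<subseteq> hom G circle_group" "\<And>\<psi>. \<psi> \<in> \<Psi> \<Longrightarrow> \<psi> h = 1" and \<delta>: "\<delta> > 0"
  shows "\<exists>w. finite w \<and> w \<subseteq> Y \<and> \<one> \<in> w \<and> w \<noteq> {\<one>} \<and> (\<forall>x\<in>w. inv x \<in> w) \<and>
    prefix_product (\<lambda>_. w) N \<inter> F \<subseteq> {\<one>} \<and> (\<forall>\<psi>\<in>\<Psi>. \<forall>x\<in>w. norm (\<psi> x - 1) < \<delta>) \<and>
    (\<forall>\<phi>\<in>hom G circle_group. \<forall>\<epsilon>\<le>1/2. (\<forall>x\<in>w. norm (\<phi> x - 1) \<le> \<epsilon>) \<longrightarrow> norm (\<phi> h - 1) \<le> 3 * \<epsilon>)"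
proof -
  have YG: "Y \<subseteq> carrier G" using Y(1) unfolding power_avoiding_def by blast
  have hG: "h \<in> carrier G" using h YG by blast
  define n where "n = Suc N"
  \<comment> \<open>The exponents \<open>c j + b\<close> of a product of \<open>N\<close> elements are bounded by \<open>N * n + N\<close>; the last
    summand admits the exponent \<open>1\<close> in case \<open>N = 0\<close>.\<close>
  define q where "q = N * n + N + 1"
  define S where "S = (\<lambda>(s, b). s \<otimes> h [^] b) ` (insert \<one> F \<times> {- int N..int N})"
  have "finite S" using F unfolding S_def by auto
  moreover have "S \<subseteq> carrier G" using F(2) hG unfolding S_def by auto
  moreover have "\<delta> / Suc n > 0" using \<delta> by simp
  ultimately obtain e :: "nat \<Rightarrow> 'a" where e: "\<And>j. e j \<in> Y"
    "\<And>j \<psi>. j < n \<Longrightarrow> \<psi> \<in> \<Psi> \<Longrightarrow> norm (\<psi> (e j) - 1) < \<delta> / Suc n"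
    "\<And>c j. (\<forall>j<n. \<bar>c j\<bar> \<le> int q) \<Longrightarrow> finprod G (\<lambda>j. e j [^] c j) {..<n} \<in> S \<Longrightarrow> j < n \<Longrightarrow> c j = 0"
    using dissociated_near_kernel[OF Y _ _ \<Psi>(1,2), of S "\<delta> / Suc n" n q] by metis
  have eG: "e j \<in> carrier G" for j using e(1) YG by blast
  let ?u = "h \<otimes> finprod G e {..<n}"
  let ?w = "block n e ?u"
  have "finprod G e {..<k} \<in> Y" for k :: nat
  proof (induction k)
    case (Suc k)
    then show ?case using e(1) eG Y(2) by (simp add: finprod_lessThan_Suc subgroup.m_closed)
  qed (simp add: subgroup.one_closed[OF Y(2)])
  then have u: "?u \<in> Y" using h Y(2) by (simp add: subgroup.m_closed)
  have wY: "?w \<subseteq> Y" by (rule block_subset_subgroup[OF Y(2) e(1) u])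
  have "?w \<noteq> {\<one>}"
  proof
    assume w1: "?w = {\<one>}"
    have "e j [^] (1::int) \<in> ?w" if "j < n" for j using that unfolding block_def by force
    then have "finprod G (\<lambda>j. e j [^] (1::int)) {..<n} = finprod G (\<lambda>j. \<one>) {..<n}"
      using w1 by (intro finprod_cong') auto
    also have "\<dots> = \<one> \<otimes> h [^] (0::int)" using hG by simp
    also have "\<dots> \<in> S" unfolding S_def by (intro image_eqI[of _ _ "(\<one>, 0)"]) auto
    finally have "(1::int) = 0" by (intro e(3)[of "\<lambda>_. 1" 0]) (auto simp: q_def n_def)
    then show False by simp
  qed
  moreover have "x = \<one>" if x: "x \<in> prefix_product (\<lambda>_. ?w) N" "x \<in> F" for x
  proof (rule block_products_avoid[OF eG hG F(2) _ _ x])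
    show "N < n" by (simp add: n_def)
    fix c :: "nat \<Rightarrow> int" and j
    assume c: "\<forall>j<n. \<bar>c j\<bar> \<le> int (N * n + N)" "j < n"
      and "finprod G (\<lambda>j. e j [^] c j) {..<n} \<in> (\<lambda>(s, b). s \<otimes> h [^] b) ` (F \<times> {- int N..int N})"
    then have "finprod G (\<lambda>j. e j [^] c j) {..<n} \<in> S" unfolding S_def by blast
    moreover have "\<forall>j<n. \<bar>c j\<bar> \<le> int q" using c(1) by (auto simp: q_def intro: order_trans)
    ultimately show "c j = 0" using e(3) c(2) by blast
  qed
  moreover have "norm (\<psi> x - 1) < \<delta>" if "\<psi> \<in> \<Psi>" "x \<in> ?w" for \<psi> x
  proof (rule block_near_kernel[OF _ eG hG _ _ \<delta> that(2)])
    show "\<psi> \<in> hom G circle_group" "\<psi> h = 1" using that \<Psi> by auto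
    show "norm (\<psi> (e j) - 1) < \<delta> / Suc n" if "j < n" for j using e(2)[OF that \<open>\<psi> \<in> \<Psi>\<close>] .
  qed
  moreover have "norm (\<phi> h - 1) \<le> 3 * \<epsilon>"
    if "\<phi> \<in> hom G circle_group" "\<epsilon> \<le> 1 / 2" "\<forall>x\<in>?w. norm (\<phi> x - 1) \<le> \<epsilon>" for \<phi> \<epsilon>
    
  proof (rule block_forces_small[where e = e, OF that(1) eG hG _ that(2)])
    show "n > 0" by (simp add: n_def)
  qed (use that(3) in blast)
  moreover have "\<one> \<in> ?w" by (simp add: block_def)
  moreover have "inv x \<in> ?w" if "x \<in> ?w" for x
    using block_inv[OF eG _ that] u YG by blast
  ultimately show ?thesis using wY block_finite by (intro exI[of _ ?w]) blast
qed

end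

section \<open>The topology of a sequence of forcing sets\<close>

text \<open>The data at the end of the construction. In \<open>w_avoid\<close> at most \<open>k\<close> factors come from each \<open>w k\<close>: if
  the factors from \<open>w n\<close> complete a product of factors from the earlier sets to one of the earlier
  elements \<open>h i\<close>, then they cancel among themselves.\<close>

locale forcing_sets = comm_group G for G (structure) +
  fixes H Y :: "'a set" and h :: "nat \<Rightarrow> 'a" and w :: "nat \<Rightarrow> 'a set" and \<psi> :: "nat \<Rightarrow> 'a \<Rightarrow> complex"
  assumes H: "subgroup H G" and h_in: "h n \<in> H"
    and h_repeats: "x \<in> H \<Longrightarrow> \<exists>n\<ge>m. h n = x"
    and Y: "subgroup Y G"
    and w_finite: "finite (w n)" and w_closed: "w n \<subseteq> Y"
    and w_one: "\<one> \<in> w n" and w_nontrivial: "w n \<noteq> {\<one>}"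
    and w_inv: "x \<in> w n \<Longrightarrow> inv x \<in> w n"
    and w_avoid: "\<lbrakk>i < n; y \<in> prefix_product (\<lambda>k. prefix_product (\<lambda>_. w k) k) n;
      z \<in> prefix_product (\<lambda>_. w n) n; y \<otimes> z = h i\<rbrakk> \<Longrightarrow> z = \<one>"
    and \<psi>_hom: "\<psi> j \<in> hom G circle_group"
    and \<psi>_small: "j \<le> n \<Longrightarrow> x \<in> w n \<Longrightarrow> norm (\<psi> j x - 1) < 1 / 2 ^ n"
    and \<psi>_separates: "x \<in> Y \<Longrightarrow> x \<notin> H \<Longrightarrow> \<exists>j. \<psi> j x \<noteq> 1"
    and w_forces: "\<lbrakk>\<phi> \<in> hom G circle_group; \<epsilon> \<le> 1 / 2; \<And>x. x \<in> w n \<Longrightarrow> norm (\<phi> x - 1) \<le> \<epsilon>\<rbrakk>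
      \<Longrightarrow> norm (\<phi> (h n) - 1) \<le> 3 * \<epsilon>"
begin

definition tail :: "nat \<Rightarrow> 'a set" where
  "tail n = (\<Union>k\<in>{n..}. w k)"

lemma Y_carrier: "Y \<subseteq> carrier G"
  by (rule subgroup.subset[OF Y])

lemma w_carrier [simp]: "x \<in> w n \<Longrightarrow> x \<in> carrier G"
  using w_closed Y_carrier by blast

lemma h_carrier [simp]: "h n \<in> carrier G"
  using h_in subgroup.mem_carrier[OF H] by blast

lemma w_subset_tail: "n \<le> k \<Longrightarrow> w k \<subseteq> tail n"
  unfolding tail_def by auto

sublocale null_sets G tail
proof
  show "tail n \<subseteq> carrier G" for n by (auto simp: tail_def)
  show "\<one> \<in> tail n" for n using w_one by (auto simp: tail_def)
  show "inv x \<in> tail n" if "x \<in> tail n" for x n using that w_inv by (auto simp: tail_def)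
  show "tail m \<subseteq> tail n" if "n \<le> m" for n m using that by (fastforce simp: tail_def)
  show "finite (tail 0 - tail n)" for n
  proof (rule finite_subset)
    show "tail 0 - tail n \<subseteq> (\<Union>k<n. w k)"
      by (auto simp: tail_def) (meson atLeast_iff lessThan_iff not_le)
    show "finite (\<Union>k<n. w k)" using w_finite by blast
  qed
qed

lemma continuous_iff_small_on_tails:
  assumes "\<phi> \<in> hom G circle_group"
  shows "\<phi> \<in> continuous_characters G nbhd_topology \<longleftrightarrow>
    (\<forall>\<epsilon>>0. \<exists>n. \<forall>a\<in>tail n. norm (\<phi> a - 1) < \<epsilon>)"
  using continuous_character_iff[OF assms] assms by (simp add: continuous_characters_def)

lemma \<psi>_continuous: "\<psi> j \<in> continuous_characters G nbhd_topology"
  unfolding continuous_iff_small_on_tails[OF \<psi>_hom]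
proof (intro allI impI)
  fix \<epsilon> :: real assume "\<epsilon> > 0"
  then obtain N where N: "(1 / 2) ^ N < \<epsilon>" using real_arch_pow_inv[of \<epsilon> "1 / 2"] by auto
  have "norm (\<psi> j a - 1) < \<epsilon>" if a: "a \<in> tail (max j N)" for a
  proof -
    obtain k where k: "k \<ge> max j N" "a \<in> w k" using a unfolding tail_def by auto
    then have "norm (\<psi> j a - 1) < 1 / 2 ^ k" by (intro \<psi>_small) auto
    also have "\<dots> \<le> (1 / 2) ^ N"
      using power_decreasing[of N k "1 / 2 :: real"] k by (simp add: power_one_over)
    finally show ?thesis using N by simp
  qed
  then show "\<exists>n. \<forall>a\<in>tail n. norm (\<psi> j a - 1) < \<epsilon>" by blast
qed

lemma continuous_if_trivial_on_Y:
  assumes \<phi>: "\<phi> \<in> hom G circle_group" and "\<And>y. y \<in> Y \<Longrightarrow> \<phi> y = 1"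
  shows "\<phi> \<in> continuous_characters G nbhd_topology"
proof -
  have "\<phi> a = 1" if "a \<in> tail 0" for a
    using that assms(2) w_closed unfolding tail_def by blast
  then show ?thesis unfolding continuous_iff_small_on_tails[OF \<phi>] by (intro allI impI exI[of _ 0]) auto
qed

lemma continuous_character_separates:
  assumes x: "x \<in> carrier G" "x \<notin> H"
  shows "\<exists>\<phi>\<in>continuous_characters G nbhd_topology. \<phi> x \<noteq> 1"
proof (cases "x \<in> Y")
  case True
  then show ?thesis using \<psi>_separates x \<psi>_continuous by blast
next
  case False
  then obtain \<phi> where "\<phi> \<in> hom G circle_group" "\<forall>y\<in>Y. \<phi> y = 1" "\<phi> x \<noteq> 1"
    using character_separating_subgroup[OF Y x(1)] by blast
  then show ?thesis using continuous_if_trivial_on_Y by blast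
qed

lemma continuous_character_trivial_on_H:
  assumes \<phi>: "\<phi> \<in> continuous_characters G nbhd_topology" and x: "x \<in> H"
  shows "\<phi> x = 1"
proof -
  have hom: "\<phi> \<in> hom G circle_group" using \<phi> unfolding continuous_characters_def by blast
  have "norm (\<phi> x - 1) \<le> 0 + \<epsilon>" if "\<epsilon> > 0" for \<epsilon> :: real
  proof -
    define \<delta> where "\<delta> = min (\<epsilon> / 3) (1 / 2)"
    have \<delta>: "\<delta> > 0" "\<delta> \<le> 1 / 2" "3 * \<delta> \<le> \<epsilon>" using that by (auto simp: \<delta>_def)
    obtain n where n: "\<forall>a\<in>tail n. norm (\<phi> a - 1) < \<delta>"
      using \<phi> \<delta>(1) unfolding continuous_iff_small_on_tails[OF hom] by blast
    obtain k where k: "k \<ge> n" "h k = x" using h_repeats[OF x] by blast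
    have "norm (\<phi> (h k) - 1) \<le> 3 * \<delta>"
      using n w_subset_tail[OF k(1)] by (intro w_forces[OF hom \<delta>(2)]) (auto intro: less_imp_le)
    then show ?thesis using k(2) \<delta>(3) by simp
  qed
  then have "norm (\<phi> x - 1) \<le> 0" by (rule field_le_epsilon)
  then show ?thesis by simp
qed

lemma von_neumann_radical_eq: "von_neumann_radical G nbhd_topology = H"
proof -
  have Hc: "H \<subseteq> carrier G" by (rule subgroup.subset[OF H])
  have ker: "kernel G circle_group \<phi> = {x \<in> carrier G. \<phi> x = 1}" for \<phi>
    by (simp add: kernel_def circle_group_def)
  show ?thesis
  proof
    show "H \<subseteq> von_neumann_radical G nbhd_topology"
      using continuous_character_trivial_on_H Hc unfolding von_neumann_radical_def ker by blast
    show "von_neumann_radical G nbhd_topology \<subseteq> H"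
    proof
      fix x assume x: "x \<in> von_neumann_radical G nbhd_topology"
      then have "x \<in> carrier G"
        using \<psi>_continuous[of 0] unfolding von_neumann_radical_def ker by blast
      then show "x \<in> H"
        using continuous_character_separates x unfolding von_neumann_radical_def ker by blast
    qed
  qed
qed

abbreviation level :: "nat \<Rightarrow> nat \<Rightarrow> 'a set" where
  "level k m \<equiv> prefix_product (\<lambda>_. w k) m"

lemma level_closed: "level k m \<subseteq> carrier G"
  by (rule prefix_product_closed) auto

text \<open>The \<open>j\<close>-th factor comes from some \<open>w k\<close> with \<open>k \<ge> j + l + 1\<close>. So only factors with \<open>j < k - l\<close> can
  come from \<open>w k\<close>.\<close>

lemma regroup_by_level:
  assumes "x \<in> prefix_product (\<lambda>j. tail (j + l + 1)) K"
  shows "\<exists>N s. x = finprod G s {..<N} \<and> (\<forall>k. s k \<in> level k (min K (k - l)))"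
  using assms
proof (induction K arbitrary: x)
  case 0
  then show ?case by (intro exI[of _ 0] exI[of _ "\<lambda>_. \<one>"]) simp
next
  case (Suc K)
  then obtain y a where y: "y \<in> prefix_product (\<lambda>j. tail (j + l + 1)) K"
    and a: "a \<in> tail (K + l + 1)" and x: "x = y \<otimes> a"
    by (auto simp: mem_set_mult)
  obtain N s where N: "y = finprod G s {..<N}" and s: "\<And>k. s k \<in> level k (min K (k - l))"
    using Suc.IH[OF y] by blast
  obtain i where i: "i \<ge> K + l + 1" "a \<in> w i" using a unfolding tail_def by auto
  have aG: "a \<in> carrier G" using i by simp
  have sG: "s k \<in> carrier G" for k using s level_closed by blast
  define t where "t k = (if k < N then s k else \<one>) \<otimes> (if i = k then a else \<one>)" for k
  let ?M = "N + Suc i"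
  have "finprod G t {..<?M} = finprod G (\<lambda>k. if k < N then s k else \<one>) {..<?M}
      \<otimes> finprod G (\<lambda>k. if i = k then a else \<one>) {..<?M}"
    unfolding t_def using sG aG by (intro finprod_multf) auto
  also have "finprod G (\<lambda>k. if i = k then a else \<one>) {..<?M} = a"
    using finprod_singleton[of i "{..<?M}" "\<lambda>_. a"] aG by simp
  also have "finprod G (\<lambda>k. if k < N then s k else \<one>) {..<?M} = finprod G s {..<N}"
    by (rule finprod_mono_neutral_cong_right) (use sG in auto)
  finally have "x = finprod G t {..<?M}" using x N by simp
  moreover have "t k \<in> level k (min (Suc K) (k - l))" for k
  proof -
    have mono: "level k (min K (k - l)) \<subseteq> level k (min (Suc K) (k - l))"
      by (rule prefix_product_subset_later) (auto simp: w_one)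
    have "\<one> \<in> level k (min K (k - l))" by (rule one_in_prefix_product) (rule w_one)
    then have s': "(if k < N then s k else \<one>) \<in> level k (min K (k - l))" using s by simp
    show ?thesis
    proof (cases "i = k")
      case True
      then have "min (Suc K) (k - l) = Suc (min K (k - l))" using i(1) by auto
      then have "level k (min (Suc K) (k - l)) = level k (min K (k - l)) <#> w k"
        by (simp only: prefix_product.simps)
      moreover have "a \<in> w k" using i(2) True by simp
      ultimately have "(if k < N then s k else \<one>) \<otimes> a \<in> level k (min (Suc K) (k - l))"
        using s' mem_set_mult by blast
      then show ?thesis using True by (simp add: t_def)
    next
      case False
      then have "t k = (if k < N then s k else \<one>)" using sG by (simp add: t_def)
      then show ?thesis using s' mono by auto
    qed
  qed
  ultimately show ?case by blast
qed

lemma finprod_levels: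
  assumes "\<And>k. s k \<in> level k k"
  shows "finprod G s {..<n} \<in> prefix_product (\<lambda>k. level k k) n"
proof (induction n)
  case (Suc n)
  have "s k \<in> carrier G" for k using assms level_closed by blast
  then show ?case using Suc assms by (auto simp: finprod_lessThan_Suc mem_set_mult)
qed simp

text \<open>The levels above \<open>l\<close> are removed from the top: the highest one is trivial by \<open>w_avoid\<close>.\<close>

lemma levels_avoid:
  assumes s: "\<And>k. s k \<in> level k k" and triv: "\<And>k. k \<le> l \<Longrightarrow> s k = \<one>"
    and eq: "finprod G s {..<N} = h l"
  shows "h l = \<one>"
  using eq
proof (induction N)
  case (Suc N)
  have sG: "s k \<in> carrier G" for k using s level_closed by blast
  then have fG: "finprod G s {..<N} \<in> carrier G" by (auto intro!: finprod_closed)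
  have eq: "finprod G s {..<N} \<otimes> s N = h l" using Suc.prems sG by (simp add: finprod_lessThan_Suc)
  have "s N = \<one>"
  proof (cases "N \<le> l")
    case False
    then show ?thesis using w_avoid[OF _ finprod_levels[OF s] s eq] by simp
  qed (rule triv)
  then show ?case using Suc.IH eq fG by simp
qed simp

text \<open>The two kinds of points need different arguments: no continuous character can tell a point of \<open>H\<close>
  from the identity, so for these the sparseness of the \<open>w n\<close> is used.\<close>

lemma Hausdorff: "Hausdorff_space nbhd_topology"
proof (rule Hausdorff_nbhd_topology)
  fix x assume x: "x \<in> carrier G" "x \<noteq> \<one>"
  show "\<exists>f. x \<notin> nbhd f"
  proof (cases "x \<in> H")
    case True
    then obtain l where l: "h l = x" using h_repeats by blast
    have "x \<notin> nbhd (\<lambda>j. j + l + 1)"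
    proof
      assume "x \<in> nbhd (\<lambda>j. j + l + 1)"
      then obtain K where "x \<in> prefix_product (\<lambda>j. tail (j + l + 1)) K" unfolding nbhd_def by blast
      then obtain N s where N: "x = finprod G s {..<N}"
        and s: "\<And>k. s k \<in> level k (min K (k - l))" using regroup_by_level by blast
      have "level k (min K (k - l)) \<subseteq> level k k" for k
        by (rule prefix_product_subset_later) (auto simp: w_one)
      then have "s k \<in> level k k" for k using s by blast
      moreover have "s k = \<one>" if "k \<le> l" for k using s[of k] that by simp
      ultimately have "h l = \<one>" using N l by (intro levels_avoid) auto
      then show False using x l by simp
    qed
    then show ?thesis by blast
  next
    case False
    then obtain \<phi> where \<phi>: "\<phi> \<in> continuous_characters G nbhd_topology" "\<phi> x \<noteq> 1"
      using continuous_character_separates x by blast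
    then have hom: "\<phi> \<in> hom G circle_group" unfolding continuous_characters_def by blast
    have "openin nbhd_topology {y \<in> topspace nbhd_topology. \<phi> y \<in> - {\<phi> x}}"
      using \<phi> unfolding continuous_characters_def
      by (intro openin_continuous_map_preimage[of _ euclidean]) (auto simp: continuous_map_in_subtopology)
    moreover have "\<one> \<in> {y \<in> topspace nbhd_topology. \<phi> y \<in> - {\<phi> x}}" using hom \<phi>(2) by auto
    ultimately obtain f where
      f: "\<forall>u\<in>nbhd f. \<one> \<otimes> u \<in> {y \<in> topspace nbhd_topology. \<phi> y \<in> - {\<phi> x}}"
      unfolding openin_nbhd_topology by blast
    then have "x \<notin> nbhd f" using x(1) by auto
    then show ?thesis by blast
  qed
qed

lemma H_in_NRC: "H \<in> NRC G"
proof -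
  have "tail n \<noteq> {\<one>}" for n
    using w_subset_tail[of n n] w_nontrivial[of n] w_one[of n] by blast
  then have "nbhd_topology \<noteq> discrete_topology (carrier G)" by (rule nbhd_topology_not_discrete)
  then show ?thesis
    unfolding NRC_def
    using H group_topology_nbhd complete_nbhd_topology Hausdorff von_neumann_radical_eq by blast
qed

end

section \<open>Every countable subgroup is a radical\<close>

context comm_group
begin

text \<open>The sets \<open>w n\<close> are chosen recursively by \<open>forcing_set\<close>, where \<open>Q n\<close> records the products with at most
  \<open>k\<close> factors from \<open>w k\<close> for each \<open>k < n\<close>, all of which are known when \<open>w n\<close> is chosen.\<close>

lemma countable_subgroup_in_NRC:
  assumes unb: "group_exp G = \<infinity>" and H: "subgroup H G" "countable H"
  shows "H \<in> NRC G"
proof -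
  have HG: "H \<subseteq> carrier G" by (rule subgroup.subset[OF H(1)])
  have H_one: "\<one> \<in> H" by (rule subgroup.one_closed[OF H(1)])
  obtain C where C: "countable C" "power_avoiding C" using countable_power_avoiding[OF unb] by blast
  have CG: "C \<subseteq> carrier G" using C(2) unfolding power_avoiding_def by blast
  obtain Y where Y: "subgroup Y G" "countable Y" "H \<union> C \<subseteq> Y"
    using countable_subgroup_superset[of "H \<union> C"] C(1) H(2) CG HG by auto
  have YG: "Y \<subseteq> carrier G" by (rule subgroup.subset[OF Y(1)])
  have pY: "power_avoiding Y" using C(2) Y(3) YG unfolding power_avoiding_def by blast

  \<comment> \<open>Decoding the index as a pair makes every element of \<open>H\<close> occur infinitely often.\<close>
  define h where "h n = from_nat_into H (fst (prod_decode n))" for n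
  have h_in: "h n \<in> H" for n unfolding h_def using H_one by (intro from_nat_into) auto
  have h_repeats: "\<exists>n\<ge>m. h n = x" if x: "x \<in> H" for x m
  proof -
    obtain i where i: "from_nat_into H i = x" using from_nat_into_surj[OF H(2) x] by blast
    have "prod_encode (i, m) \<ge> m" by (rule le_prod_encode_2)
    moreover have "h (prod_encode (i, m)) = x" by (simp add: h_def i)
    ultimately show ?thesis by blast
  qed

  define separating where "separating y \<phi> \<longleftrightarrow> \<phi> \<in> hom G circle_group \<and> (\<forall>a\<in>H. \<phi> a = 1) \<and>
    (y \<in> Y - H \<longrightarrow> \<phi> y \<noteq> 1)" for y and \<phi> :: "'a \<Rightarrow> complex"
  have "\<exists>\<phi>. separating y \<phi>" for y
  proof (cases "y \<in> Y - H")
    case True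
    then have "y \<in> carrier G" "y \<notin> H" using YG by auto
    then show ?thesis
      using character_separating_subgroup[OF H(1), of y] unfolding separating_def by blast
  next
    case False
    have "(\<lambda>_. 1) \<in> hom G circle_group" by (rule homI) (simp_all add: circle_group_def)
    then have "separating y (\<lambda>_. 1)" using False unfolding separating_def by blast
    then show ?thesis by blast
  qed
  then have "separating y (SOME \<phi>. separating y \<phi>)" for y by (rule someI_ex)
  moreover define \<Phi> where "\<Phi> y = (SOME \<phi>. separating y \<phi>)" for y
  ultimately have "separating y (\<Phi> y)" for y by simp
  then have \<Phi>: "\<Phi> y \<in> hom G circle_group" "a \<in> H \<Longrightarrow> \<Phi> y a = 1" "y \<in> Y - H \<Longrightarrow> \<Phi> y y \<noteq> 1" for y a
    unfolding separating_def by blast+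
  define \<psi> where "\<psi> j = \<Phi> (from_nat_into Y j)" for j

  define good where "good n Q w \<longleftrightarrow> finite w \<and> w \<subseteq> Y \<and> \<one> \<in> w \<and> w \<noteq> {\<one>} \<and> (\<forall>x\<in>w. inv x \<in> w) \<and>
    prefix_product (\<lambda>_. w) n \<inter> (\<lambda>(i, y). h i \<otimes> inv y) ` ({..<n} \<times> Q) \<subseteq> {\<one>} \<and>
    (\<forall>\<psi>'\<in>\<psi> ` {..n}. \<forall>x\<in>w. norm (\<psi>' x - 1) < 1 / 2 ^ n) \<and>
    (\<forall>\<phi>\<in>hom G circle_group. \<forall>\<epsilon>\<le>1/2. (\<forall>x\<in>w. norm (\<phi> x - 1) \<le> \<epsilon>) \<longrightarrow> norm (\<phi> (h n) - 1) \<le> 3 * \<epsilon>)"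
    for n Q w
  have good_ex: "\<exists>w. good n Q w" if Q: "finite Q" "Q \<subseteq> carrier G" for n Q
    unfolding good_def
  proof (rule forcing_set[OF pY Y(1)])
    show "h n \<in> Y" using h_in Y(3) by blast
    show "finite ((\<lambda>(i, y). h i \<otimes> inv y) ` ({..<n} \<times> Q))" using Q by simp
    show "(\<lambda>(i, y). h i \<otimes> inv y) ` ({..<n} \<times> Q) \<subseteq> carrier G" using Q h_in HG by auto
    show "finite (\<psi> ` {..n})" by simp
    show "\<psi> ` {..n} \<subseteq> hom G circle_group" using \<Phi>(1) by (auto simp: \<psi>_def)
    show "\<psi>' (h n) = 1" if "\<psi>' \<in> \<psi> ` {..n}" for \<psi>' using that \<Phi>(2) h_in by (auto simp: \<psi>_def)
  qed simp
  have pick: "good n Q (SOME w. good n Q w)" if "finite Q" "Q \<subseteq> carrier G" for n Q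
    using good_ex[OF that] by (rule someI_ex)
  define pick where "pick n Q = (SOME w. good n Q w)" for n Q
  define Q where "Q = rec_nat {\<one>} (\<lambda>n Q. Q <#> prefix_product (\<lambda>_. pick n Q) n)"
  define w where "w n = pick n (Q n)" for n
  have Q_Suc: "Q (Suc n) = Q n <#> prefix_product (\<lambda>_. w n) n" for n by (simp add: Q_def w_def)
  have Q_eq: "Q n = prefix_product (\<lambda>k. prefix_product (\<lambda>_. w k) k) n" for n
    by (induction n) (simp_all add: Q_Suc, simp add: Q_def)
  have Q_fin: "finite (Q n) \<and> Q n \<subseteq> carrier G" for n
  proof (induction n)
    case 0
    show ?case by (simp add: Q_def)
  next
    case (Suc n)
    then have "good n (Q n) (w n)" using pick unfolding w_def pick_def by blast
    then have "finite (w n)" "w n \<subseteq> carrier G" using YG unfolding good_def by blast+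
    then have "finite (prefix_product (\<lambda>_. w n) n)" "prefix_product (\<lambda>_. w n) n \<subseteq> carrier G"
      by (auto intro: prefix_product_finite prefix_product_closed[THEN subsetD])
    then show ?case using Suc by (auto simp: Q_Suc set_mult_def)
  qed
  then have good: "good n (Q n) (w n)" for n using pick unfolding w_def pick_def by blast

  interpret forcing_sets G H Y h w \<psi>
  proof (intro forcing_sets.intro forcing_sets_axioms.intro)
    show "comm_group G" by (rule comm_group_axioms)
    show "subgroup H G" "subgroup Y G" by fact+
    show "h n \<in> H" for n by (rule h_in)
    show "\<exists>n\<ge>m. h n = x" if "x \<in> H" for x m using that by (rule h_repeats)
    show "finite (w n)" "w n \<subseteq> Y" "\<one> \<in> w n" "w n \<noteq> {\<one>}" for n using good[of n] unfolding good_def by blast+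
    show "inv x \<in> w n" if "x \<in> w n" for x n using good[of n] that unfolding good_def by blast
    show "\<psi> j \<in> hom G circle_group" for j using \<Phi>(1) by (simp add: \<psi>_def)
    show "norm (\<psi> j x - 1) < 1 / 2 ^ n" if "j \<le> n" "x \<in> w n" for j x n
      using good[of n] that unfolding good_def by blast
    show "\<exists>j. \<psi> j x \<noteq> 1" if x: "x \<in> Y" "x \<notin> H" for x
    proof -
      obtain j where "from_nat_into Y j = x" using from_nat_into_surj[OF Y(2) x(1)] by blast
      then show ?thesis using \<Phi>(3)[of x] x by (intro exI[of _ j]) (simp add: \<psi>_def)
    qed
    show "norm (\<phi> (h n) - 1) \<le> 3 * \<epsilon>"
      if "\<phi> \<in> hom G circle_group" "\<epsilon> \<le> 1 / 2" "\<And>x. x \<in> w n \<Longrightarrow> norm (\<phi> x - 1) \<le> \<epsilon>" for \<phi> \<epsilon> n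
      using good[of n] that unfolding good_def by blast
    show "z = \<one>" if i: "i < n" and y: "y \<in> prefix_product (\<lambda>k. prefix_product (\<lambda>_. w k) k) n"
      and z: "z \<in> prefix_product (\<lambda>_. w n) n" and yz: "y \<otimes> z = h i" for i n y z
    proof -
      have yQ: "y \<in> Q n" using y Q_eq by simp
      then have yG: "y \<in> carrier G" using Q_fin by blast
      have "w n \<subseteq> carrier G" using good[of n] YG unfolding good_def by blast
      then have zG: "z \<in> carrier G" using prefix_product_closed[of n "\<lambda>_. w n"] z by blast
      have "z = h i \<otimes> inv y" using yz yG zG by (metis inv_solve_right' m_closed m_comm)
      then have "z \<in> (\<lambda>(i, y). h i \<otimes> inv y) ` ({..<n} \<times> Q n)"
        using i yQ by (intro image_eqI[of _ _ "(i, y)"]) auto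
      then show ?thesis using good[of n] z unfolding good_def by blast
    qed
  qed
  show ?thesis by (rule H_in_NRC)
qed

end

theorem theorem1:
  fixes G :: "('a, 'b) monoid_scheme" and H :: "'a set"
  assumes "comm_group G" and "infinite (carrier G)" and "group_exp G = \<infinity>"
    and "torsion_subgroup H G" and "countable H"
  shows "H \<in> NRC G"
  using comm_group.countable_subgroup_in_NRC[OF assms(1,3)] assms(4,5)
  by (simp add: torsion_subgroup_def)

end
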